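(* Let $P_\lambda,P_\mu$ be Poisson PP distributions with sigma-finite intensity measures $\lambda,\mu$ on a measurable space $(S,\mathcal S)$. There exists a Poisson PP distribution $P_\xi$ (with a sigma-finite intensity measure $\xi$ on $(S,\mathcal S)$) such that $P_\lambda\ll P_\xi$ and $P_\mu\ll P_\xi$ if and only if $H(\lambda,\mu)<\infty$.
   Context: Point patterns: $N(S)$ is the set of measures on $(S,\mathcal S)$ that can be written as a countable sum of integer-valued finite measures, equipped with the sigma-algebra $\mathcal N(S)$ generated by the evaluation maps $\eta\mapsto\eta(B)$, $B\in\mathcal S$. Poisson PP distribution: for a sigma-finite measure $\lambda$ on $(S,\mathcal S)$, $P_\lambda$ is the unique probability measure on $(N(S),\mathcal N(S))$ under which $\eta(B_1),\dots,\eta(B_n)$ are independent for all $n\ge1$ and mutually disjoint $B_1,\dots,B_n\in\mathcal S$, and $\eta(B)$ is Poisson distributed with mean $\lambda(B)$ for every $B\in\mathcal S$ (with $\mathrm{Poi}(0)=\delta_0$, $\mathrm{Poi}(\infty)=\delta_\infty$). Hellinger distance of sigma-finite measures: $H(\lambda,\mu)=\left(\frac12\int_S(\sqrt f-\sqrt g)^2\,d\nu\right)^{1/2}\in[0,\infty]$, where $f,g$ are densities of $\lambda,\mu$ with respect to a sigma-finite measure $\nu$ (the value does not depend on the choice). As usual, $P\ll Q$ means that $Q(A)=0$ implies $P(A)=0$. *)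

theory Defs
  imports "HOL-Probability.Probability"
begin

section \<open>Point patterns\<close>

definition point_patterns :: "'a measure \<Rightarrow> 'a measure set" where
  "point_patterns S = {\<eta>. sets \<eta> = sets S \<and>
     (\<exists>m :: nat \<Rightarrow> 'a measure.
        (\<forall>k. sets (m k) = sets S \<and> finite_measure (m k) \<and> (\<forall>B\<in>sets S. emeasure (m k) B \<in> \<nat>)) \<and>
        (\<forall>B\<in>sets S. emeasure \<eta> B = (\<Sum>k. emeasure (m k) B)))}"

text \<open>Only the \<open>\<sigma>\<close>-algebra of \<^term>\<open>point_pattern_space S\<close> carries information, as for
  \<^const>\<open>subprob_algebra\<close>; the same applies to the measurable space \<open>S\<close> itself.\<close>

definition point_pattern_space :: "'a measure \<Rightarrow> 'a measure measure" where
  "point_pattern_space S =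
     (SUP B\<in>sets S. vimage_algebra (point_patterns S) (\<lambda>\<eta>. emeasure \<eta> B) borel)"

lemma space_point_pattern_space: "space (point_pattern_space S) = point_patterns S"
proof -
  have "sets S \<noteq> {}" by auto
  then show ?thesis
    unfolding point_pattern_space_def by (subst space_Sup_eq_UN) auto
qed

lemma measurable_emeasure_point_pattern_space:
  "B \<in> sets S \<Longrightarrow> (\<lambda>\<eta>. emeasure \<eta> B) \<in> borel_measurable (point_pattern_space S)"
  unfolding point_pattern_space_def
  by (rule measurable_Sup1[OF imageI]) (auto intro!: measurable_vimage_algebra1)

section \<open>Poisson point pattern distributions\<close>

text \<open>The mean 0 is treated separately because \<^const>\<open>poisson_pmf\<close> is specified
  for positive rates only.\<close>

definition poisson_distribution :: "ennreal \<Rightarrow> ennreal measure" where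
  "poisson_distribution r =
     (if r = 0 then return borel 0
      else if r = \<infinity> then return borel \<infinity>
      else distr (measure_pmf (poisson_pmf (enn2real r))) borel of_nat)"

definition poisson_PP :: "'a measure \<Rightarrow> 'a measure \<Rightarrow> 'a measure measure \<Rightarrow> bool" where
  "poisson_PP S \<Lambda> P \<longleftrightarrow>
     sets \<Lambda> = sets S \<and> sigma_finite_measure \<Lambda> \<and>
     sets P = sets (point_pattern_space S) \<and> prob_space P \<and>
     (\<forall>n\<ge>1. \<forall>B :: nat \<Rightarrow> 'a set.
        (\<forall>i\<in>{1..n}. B i \<in> sets S) \<and> disjoint_family_on B {1..n} \<longrightarrow>
        prob_space.indep_vars P (\<lambda>_. borel) (\<lambda>i \<eta>. emeasure \<eta> (B i)) {1..n}) \<and>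
     (\<forall>B\<in>sets S. distr P borel (\<lambda>\<eta>. emeasure \<eta> B) = poisson_distribution (emeasure \<Lambda> B))"

section \<open>Hellinger distance\<close>

definition is_density :: "'a measure \<Rightarrow> 'a measure \<Rightarrow> ('a \<Rightarrow> real) \<Rightarrow> bool" where
  "is_density \<nu> \<Lambda> f \<longleftrightarrow>
     f \<in> borel_measurable \<nu> \<and> (\<forall>x\<in>space \<nu>. 0 \<le> f x) \<and> density \<nu> (\<lambda>x. ennreal (f x)) = \<Lambda>"

definition sqrt_ennreal :: "ennreal \<Rightarrow> ennreal" where
  "sqrt_ennreal x = (if x = \<infinity> then \<infinity> else ennreal (sqrt (enn2real x)))"

definition hellinger_integral :: "'a measure \<Rightarrow> ('a \<Rightarrow> real) \<Rightarrow> ('a \<Rightarrow> real) \<Rightarrow> ennreal" where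
  "hellinger_integral \<nu> f g =
     sqrt_ennreal ((1 / 2) * (\<integral>\<^sup>+x. ennreal ((sqrt (f x) - sqrt (g x))\<^sup>2) \<partial>\<nu>))"

definition hellinger :: "'a measure \<Rightarrow> 'a measure \<Rightarrow> ennreal" where
  "hellinger \<Lambda> M = (THE h. \<exists>\<nu> f g. sigma_finite_measure \<nu> \<and> is_density \<nu> \<Lambda> f \<and> is_density \<nu> M g \<and>
     h = hellinger_integral \<nu> f g)"

text \<open>The value does not depend on the choice of the dominating measure: both integrals equal
  the one taken with respect to \<open>\<Lambda> + M\<close>, which is the measure with density \<open>f + g\<close>.\<close>

lemma hellinger_change_measure:
  fixes f g :: "'a \<Rightarrow> real"
  assumes "sigma_finite_measure \<nu>" and "is_density \<nu> \<Lambda> f" and "is_density \<nu> M g"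
  defines "\<rho> \<equiv> density \<nu> (\<lambda>x. ennreal (f x + g x))"
  shows "sigma_finite_measure \<rho>"
    and "sets \<rho> = sets \<Lambda>"
    and "\<And>B. B \<in> sets \<Lambda> \<Longrightarrow> emeasure \<rho> B = emeasure \<Lambda> B + emeasure M B"
    and "is_density \<rho> \<Lambda> (\<lambda>x. f x / (f x + g x))"
    and "is_density \<rho> M (\<lambda>x. g x / (f x + g x))"
    and "hellinger_integral \<nu> f g = hellinger_integral \<rho> (\<lambda>x. f x / (f x + g x)) (\<lambda>x. g x / (f x + g x))"
proof -
  interpret sigma_finite_measure \<nu> by fact
  have [measurable]: "f \<in> borel_measurable \<nu>" "g \<in> borel_measurable \<nu>"
    and nn: "\<And>x. x \<in> space \<nu> \<Longrightarrow> 0 \<le> f x" "\<And>x. x \<in> space \<nu> \<Longrightarrow> 0 \<le> g x"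
    and L: "\<Lambda> = density \<nu> (\<lambda>x. ennreal (f x))" and M: "M = density \<nu> (\<lambda>x. ennreal (g x))"
    using assms unfolding is_density_def by auto
  show "sigma_finite_measure \<rho>"
    unfolding \<rho>_def by (subst sigma_finite_iff_density_finite) auto
  show "sets \<rho> = sets \<Lambda>" by (simp add: \<rho>_def L)
  show "emeasure \<rho> B = emeasure \<Lambda> B + emeasure M B" if "B \<in> sets \<Lambda>" for B
  proof -
    have "B \<in> sets \<nu>" using that by (simp add: L)
    then show ?thesis
      unfolding \<rho>_def L M
      by (simp add: emeasure_density flip: nn_integral_add)
         (intro nn_integral_cong, auto simp: nn distrib_right split: split_indicator)
  qed
  show "is_density \<rho> \<Lambda> (\<lambda>x. f x / (f x + g x))"
    unfolding is_density_def \<rho>_def L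
  proof (intro conjI ballI)
    show "density (density \<nu> (\<lambda>x. ennreal (f x + g x))) (\<lambda>x. ennreal (f x / (f x + g x)))
      = density \<nu> (\<lambda>x. ennreal (f x))"
      by (subst density_density_eq; simp?) 
         (intro density_cong AE_I2, auto simp: nn add_nonneg_eq_0_iff simp flip: ennreal_mult ennreal_plus)
  qed (auto simp: nn)
  show "is_density \<rho> M (\<lambda>x. g x / (f x + g x))"
    unfolding is_density_def \<rho>_def M
  proof (intro conjI ballI)
    show "density (density \<nu> (\<lambda>x. ennreal (f x + g x))) (\<lambda>x. ennreal (g x / (f x + g x)))
      = density \<nu> (\<lambda>x. ennreal (g x))"
      by (subst density_density_eq; simp?) 
         (intro density_cong AE_I2, auto simp: nn add_nonneg_eq_0_iff simp flip: ennreal_mult ennreal_plus)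
  qed (auto simp: nn)
  have eq: "(f x + g x) * (sqrt (f x / (f x + g x)) - sqrt (g x / (f x + g x)))\<^sup>2 = (sqrt (f x) - sqrt (g x))\<^sup>2"
    if x: "x \<in> space \<nu>" for x
  proof (cases "f x + g x = 0")
    case True
    then have "f x = 0" "g x = 0" using nn[OF x] by auto
    then show ?thesis by simp
  next
    case False
    then have pos: "f x + g x > 0" using nn[OF x] by auto
    have "(sqrt (f x / (f x + g x)) - sqrt (g x / (f x + g x))) = (sqrt (f x) - sqrt (g x)) / sqrt (f x + g x)"
      by (simp add: real_sqrt_divide diff_divide_distrib)
    then show ?thesis using pos by (simp add: power_divide)
  qed
  show "hellinger_integral \<nu> f g = hellinger_integral \<rho> (\<lambda>x. f x / (f x + g x)) (\<lambda>x. g x / (f x + g x))"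
    unfolding hellinger_integral_def \<rho>_def
    by (subst nn_integral_density; simp?)
       (intro arg_cong[where f = sqrt_ennreal] arg_cong2[where f = "(*)"] refl nn_integral_cong,
        auto simp: nn eq simp flip: ennreal_mult ennreal_plus)
qed

lemma hellinger_integral_unique:
  fixes f g f' g' :: "'a \<Rightarrow> real"
  assumes 1: "sigma_finite_measure \<nu>" "is_density \<nu> \<Lambda> f" "is_density \<nu> M g"
    and 2: "sigma_finite_measure \<nu>'" "is_density \<nu>' \<Lambda> f'" "is_density \<nu>' M g'"
  shows "hellinger_integral \<nu> f g = hellinger_integral \<nu>' f' g'"
proof -
  define \<rho> where "\<rho> = density \<nu> (\<lambda>x. ennreal (f x + g x))"
  note c1 = hellinger_change_measure[OF 1, folded \<rho>_def]
  note c2 = hellinger_change_measure[OF 2]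
  have \<rho>': "density \<nu>' (\<lambda>x. ennreal (f' x + g' x)) = \<rho>"
    by (rule measure_eqI) (use c1(2,3) c2(2,3) in auto)
  note c2 = c2[unfolded \<rho>']
  interpret sigma_finite_measure \<rho> by (rule c1)
  have uniq: "AE x in \<rho>. h x = h' x"
    if "is_density \<rho> K h" "is_density \<rho> K h'" for h h' :: "'a \<Rightarrow> real" and K
  proof -
    have "AE x in \<rho>. ennreal (h x) = ennreal (h' x)"
      using that by (subst density_unique_iff[symmetric]) (auto simp: is_density_def)
    then show ?thesis
      by (rule AE_mp) (use that in \<open>auto simp: is_density_def intro!: AE_I2\<close>)
  qed
  have "hellinger_integral \<rho> (\<lambda>x. f x / (f x + g x)) (\<lambda>x. g x / (f x + g x)) =
        hellinger_integral \<rho> (\<lambda>x. f' x / (f' x + g' x)) (\<lambda>x. g' x / (f' x + g' x))"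
    unfolding hellinger_integral_def
    using uniq[OF c1(4) c2(4)] uniq[OF c1(5) c2(5)]
    by (intro arg_cong[where f = sqrt_ennreal] arg_cong2[where f = "(*)"] refl nn_integral_cong_AE)
       (auto elim!: AE_mp)
  then show ?thesis using c1(6) c2(6) by simp
qed

lemma hellinger_eq:
  assumes "sigma_finite_measure \<nu>" "is_density \<nu> \<Lambda> f" "is_density \<nu> M g"
  shows "hellinger \<Lambda> M = hellinger_integral \<nu> f g"
  unfolding hellinger_def
  using assms by (intro the_equality) (auto intro: hellinger_integral_unique)

end

theory Submission
  imports Defs
begin

text \<open>
  On finitely many disjoint cells of finite mean, the counts of a Poisson process are independent
  Poisson variables, so densities, second moments and affinities of their joint laws factorise
  explicitly.

  If the Hellinger distance is finite, let \<open>\<xi> = max(f, g) \<nu>\<close>, which is \<open>\<lambda>\<close> on \<open>A = {f \<ge> g}\<close> and \<open>\<mu>\<close> off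
  \<open>A\<close>. A Poisson process with intensity \<open>\<xi>\<close> needs no general existence theorem: superpose the
  restriction to \<open>A\<close> of a process with law \<open>P\<^sub>\<lambda>\<close> and the restriction to the complement of an
  independent one with law \<open>P\<^sub>\<mu>\<close>. Since \<open>\<lambda> = \<phi> \<xi>\<close> with \<open>\<phi> \<le> 1\<close>, the integral
  \<open>\<kappa> = \<integral> (1 - \<phi>)\<^sup>2 d\<xi>\<close> is finite, and the second moment of the density of the counts is at most
  \<open>exp \<kappa>\<close>. Hence \<open>P\<^sub>\<lambda>(E) \<le> t P\<^sub>\<xi>(E) + exp \<kappa> / t\<close> for cylinder events \<open>E\<close> and all \<open>t > 0\<close>; this extends to
  the generated \<open>\<sigma>\<close>-algebra by approximation and gives absolute continuity.

  Conversely, if the Hellinger distance of \<open>\<lambda>\<close> and \<open>\<xi>\<close> is infinite, cells on which the relative gap of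
  the root densities is essentially constant make \<open>\<Sum> (sqrt \<lambda>(D) - sqrt \<xi>(D))\<^sup>2\<close> arbitrarily large. The
  affinity of the counts is the exponential of minus half this sum, so likelihood tests separate
  \<open>P\<^sub>\<lambda>\<close> and \<open>P\<^sub>\<xi>\<close>, and by the Borel--Cantelli lemma they are mutually singular. The triangle inequality
  passes from \<open>\<xi>\<close> to the pair \<open>\<lambda>, \<mu>\<close>.
\<close>

section \<open>Measure-theoretic preliminaries\<close>

lemma emeasure_distr_nn_integral:
  assumes f: "f \<in> M \<rightarrow>\<^sub>M N" and E: "E \<in> sets N"
  shows "emeasure (distr M N f) E = (\<integral>\<^sup>+x. indicator E (f x) \<partial>M)"
proof -
  have "emeasure (distr M N f) E = (\<integral>\<^sup>+x. indicator E x \<partial>distr M N f)" using E by simp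
  also have "\<dots> = (\<integral>\<^sup>+x. indicator E (f x) \<partial>M)" using f E by (intro nn_integral_distr) auto
  finally show ?thesis .
qed

text \<open>The sets that can be approximated in this sense form a sigma-algebra: complements keep
  the symmetric difference, and a countable union is first cut to a finite one. One set
  \<open>B\<close> has to serve both measures, since an inequality between \<open>P\<close> and
  \<open>Q\<close> is to be carried over from \<open>B\<close> to \<open>A\<close>. The tolerance is
  quantified inside the induction because the union case calls the hypothesis with a smaller
  one.\<close>

lemma approximation_by_algebra:
  assumes "finite_measure P" "finite_measure Q" and "algebra X G"
    and P: "sets P = sigma_sets X G" and Q: "sets Q = sigma_sets X G"
    and "A \<in> sigma_sets X G"
  shows "\<And>e. e > 0 \<Longrightarrow> \<exists>B\<in>G. measure P (sym_diff A B) < e \<and> measure Q (sym_diff A B) < e"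
  using \<open>A \<in> sigma_sets X G\<close>
proof (induction A rule: sigma_sets.induct)
  interpret G: algebra X G by fact
  case (Basic a)
  then show ?case by (intro bexI[of _ a]) auto
next
  interpret G: algebra X G by fact
  case Empty
  then show ?case by (intro bexI[of _ "{}"]) auto
next
  interpret G: algebra X G by fact
  case (Compl a)
  have "a \<subseteq> X" using Compl.hyps G.space_closed by (rule sigma_sets_into_sp[rotated])
  obtain B where B: "B \<in> G" "measure P (sym_diff a B) < e" "measure Q (sym_diff a B) < e"
    using Compl by blast
  moreover have "B \<subseteq> X" using B G.space_closed by auto
  then have "sym_diff (X - a) (X - B) = sym_diff a B" using \<open>a \<subseteq> X\<close> by auto
  ultimately show ?case by (intro bexI[of _ "X - B"]) auto
next
  interpret G: algebra X G by fact
  interpret P: finite_measure P by fact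
  interpret Q: finite_measure Q by fact
  case (Union a)
  have GP: "B \<in> sets P" "B \<in> sets Q" if "B \<in> G" for B
    using that by (auto simp: P Q)
  have aP[measurable]: "a i \<in> sets P" "a i \<in> sets Q" for i using Union.hyps by (auto simp: P Q)
  \<comment> \<open>What the first \<open>n\<close> sets miss; it decreases to the empty set, so
    finiteness of both measures makes it small.\<close>
  define b where "b n = (\<Union>i. a i) - (\<Union>i<n. a i)" for n :: nat
  have b: "b n \<in> sets P" "b n \<in> sets Q" for n by (auto simp: b_def)
  have dec: "decseq b" unfolding b_def decseq_def by (intro allI impI Diff_mono UN_mono) auto
  have int: "(\<Inter>n. b n) = {}" by (auto simp: b_def)
  have "(\<lambda>n. measure P (b n)) \<longlonglongrightarrow> 0" "(\<lambda>n. measure Q (b n)) \<longlonglongrightarrow> 0"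
    using P.finite_Lim_measure_decseq[of b] Q.finite_Lim_measure_decseq[of b] b dec int
    by (auto simp: image_subset_iff)
  from this[THEN order_tendstoD(2), of "e/2"] \<open>e > 0\<close>
  have "eventually (\<lambda>n. measure P (b n) < e/2 \<and> measure Q (b n) < e/2) sequentially"
    by (auto intro: eventually_conj)
  then obtain n where n: "measure P (b n) < e/2" "measure Q (b n) < e/2"
    by (auto simp: eventually_sequentially)
  \<comment> \<open>The \<open>n\<close> errors then sum to at most \<open>e / 2\<close>; the added
    1 keeps \<open>d\<close> positive and well defined for \<open>n = 0\<close>.\<close>
  define d where "d = e / (2 * (real n + 1))"
  have d: "d > 0" using \<open>e > 0\<close> by (auto simp: d_def)
  obtain B where B: "\<And>i. B i \<in> G" "\<And>i. measure P (sym_diff (a i) (B i)) < d"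
    "\<And>i. measure Q (sym_diff (a i) (B i)) < d"
    using Union.IH[OF d] by metis
  define B' where "B' = (\<Union>i<n. B i)"
  have B': "B' \<in> G" unfolding B'_def using B by auto
  have sub: "sym_diff (\<Union>i. a i) B' \<subseteq> b n \<union> (\<Union>i<n. sym_diff (a i) (B i))"
    by (auto simp: b_def B'_def)
  have bound: "measure R (sym_diff (\<Union>i. a i) B') < e"
    if "finite_measure R" "sets R = sigma_sets X G" "measure R (b n) < e/2"
      "\<And>i. measure R (sym_diff (a i) (B i)) < d" for R
  proof -
    interpret R: finite_measure R by fact
    have s: "a i \<in> sets R" "B i \<in> sets R" "b n \<in> sets R" "B' \<in> sets R" for i
      using aP B(1) b B' that(2) by (auto simp: P)
    have "measure R (sym_diff (\<Union>i. a i) B') \<le> measure R (b n \<union> (\<Union>i<n. sym_diff (a i) (B i)))"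
      using s sub by (intro R.finite_measure_mono) auto
    also have "\<dots> \<le> measure R (b n) + measure R (\<Union>i<n. sym_diff (a i) (B i))"
      using s by (intro measure_Un_le) auto
    also have "measure R (\<Union>i<n. sym_diff (a i) (B i)) \<le> (\<Sum>i<n. measure R (sym_diff (a i) (B i)))"
      using s by (intro R.finite_measure_subadditive_finite) auto
    also have "\<dots> \<le> real n * d"
      using sum_bounded_above[of "{..<n}" "\<lambda>i. measure R (sym_diff (a i) (B i))" d] that(4)
      by (auto simp: less_imp_le)
    also have "real n * d \<le> e/2" using \<open>e > 0\<close> by (auto simp: d_def field_simps)
    finally show ?thesis using that(3) by simp
  qed
  show ?case
    using bound[of P] bound[of Q] n B B' \<open>finite_measure P\<close> \<open>finite_measure Q\<close> P Q by blast
qed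

text \<open>Replacing \<open>A\<close> by an approximating \<open>B\<close> of the algebra costs
  \<open>d\<close> under \<open>P\<close> and \<open>t * d\<close> under \<open>Q\<close>, in total
  \<open>(1 + t) * d = e\<close>, and \<open>e\<close> is arbitrary.\<close>

lemma measure_le_affine_extend:
  fixes t c :: real
  assumes fm: "finite_measure P" "finite_measure Q" and alg: "algebra X G"
    and P: "sets P = sigma_sets X G" and Q: "sets Q = sigma_sets X G"
    and le: "\<And>B. B \<in> G \<Longrightarrow> measure P B \<le> t * measure Q B + c"
    and A: "A \<in> sigma_sets X G" and t: "t \<ge> 0"
  shows "measure P A \<le> t * measure Q A + c"
proof (rule field_le_epsilon)
  interpret P: finite_measure P by fact
  interpret Q: finite_measure Q by fact
  fix e :: real assume "e > 0"
  define d where "d = e / (1 + t)"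
  have "d > 0" using t \<open>e > 0\<close> by (auto simp: d_def)
  from approximation_by_algebra[OF fm alg P Q A this] obtain B where
    B: "B \<in> G" "measure P (sym_diff A B) < d" "measure Q (sym_diff A B) < d" by blast
  have s: "A \<in> sets P" "B \<in> sets P" "A \<in> sets Q" "B \<in> sets Q" using A B by (auto simp: P Q)
  have "measure P A \<le> measure P (B \<union> sym_diff A B)"
    using s by (intro P.finite_measure_mono) auto
  also have "\<dots> \<le> measure P B + measure P (sym_diff A B)"
    using s by (intro measure_Un_le) auto
  finally have 1: "measure P A \<le> measure P B + d" using B by simp
  have "measure Q B \<le> measure Q (A \<union> sym_diff A B)"
    using s by (intro Q.finite_measure_mono) auto
  also have "\<dots> \<le> measure Q A + measure Q (sym_diff A B)"
    using s by (intro measure_Un_le) auto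
  finally have 2: "measure Q B \<le> measure Q A + d" using B by simp
  have "measure P A \<le> t * measure Q B + c + d" using 1 le[OF B(1)] by simp
  also have "t * measure Q B \<le> t * (measure Q A + d)" using 2 t by (rule mult_left_mono)
  also have "t * (measure Q A + d) + c + d = t * measure Q A + c + (1 + t) * d"
    by (simp add: algebra_simps)
  also have "(1 + t) * d = e" using t by (simp add: d_def)
  finally show "measure P A \<le> t * measure Q A + c + e" by simp
qed

section \<open>Sums of measures and existence of real-valued densities\<close>

definition measure_add :: "'a measure \<Rightarrow> 'a measure \<Rightarrow> 'a measure" where
  "measure_add M N = measure_of (space M) (sets M) (\<lambda>B. emeasure M B + emeasure N B)"

lemma sets_measure_add [simp]: "sets (measure_add M N) = sets M"
  and space_measure_add [simp]: "space (measure_add M N) = space M"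
  by (simp_all add: measure_add_def)

lemma emeasure_measure_add:
  assumes "sets N = sets M" "B \<in> sets M"
  shows "emeasure (measure_add M N) B = emeasure M B + emeasure N B"
proof (rule emeasure_measure_of[OF measure_add_def])
  show "countably_additive (sets (measure_add M N)) (\<lambda>B. emeasure M B + emeasure N B)"
    unfolding countably_additive_def
    using assms by (auto simp: suminf_add[symmetric] suminf_emeasure)
qed (use assms sets.space_closed in \<open>auto simp: positive_def\<close>)

text \<open>The sets \<open>A i \<inter> B i\<close> of two exhaustions have finite mass under both
  measures. Both sequences are chosen increasing so that these diagonal intersections still cover
  the space.\<close>

lemma sigma_finite_measure_add:
  assumes "sigma_finite_measure M" "sigma_finite_measure N" and sets: "sets N = sets M"
  shows "sigma_finite_measure (measure_add M N)"
proof -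
  obtain A where A: "range A \<subseteq> sets M" "(\<Union>i. A i) = space M" "\<And>i. emeasure M (A i) \<noteq> \<infinity>" "incseq A"
    using sigma_finite_measure.sigma_finite_incseq[OF assms(1)] by blast
  obtain B where B: "range B \<subseteq> sets N" "(\<Union>i. B i) = space N" "\<And>i. emeasure N (B i) \<noteq> \<infinity>" "incseq B"
    using sigma_finite_measure.sigma_finite_incseq[OF assms(2)] by blast
  have sp: "space N = space M" using sets by (rule sets_eq_imp_space_eq)
  have AB: "A i \<in> sets M" "B i \<in> sets M" for i using A B sets by auto
  have fin: "emeasure (measure_add M N) (A i \<inter> B i) \<noteq> \<infinity>" for i
  proof -
    have "emeasure M (A i \<inter> B i) \<le> emeasure M (A i)" "emeasure N (A i \<inter> B i) \<le> emeasure N (B i)"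
      using AB sets by (auto intro!: emeasure_mono)
    then show ?thesis
      using A(3)[of i] B(3)[of i] AB sets by (auto simp: emeasure_measure_add top_unique)
  qed
  have cov: "(\<Union>i. A i \<inter> B i) = space M"
  proof (intro equalityI subsetI)
    fix x assume "x \<in> space M"
    then obtain i j where "x \<in> A i" "x \<in> B j" using A(2) B(2) sp by blast
    then have "x \<in> A (max i j) \<inter> B (max i j)"
      using A(4) B(4) by (meson IntI incseqD in_mono max.cobounded1 max.cobounded2)
    then show "x \<in> (\<Union>i. A i \<inter> B i)" by blast
  qed (use AB sets.sets_into_space in blast)
  show ?thesis
    by standard (rule exI[of _ "range (\<lambda>i. A i \<inter> B i)"], use fin cov AB in auto)
qed

text \<open>Domination gives absolute continuity. The Radon-Nikodym derivative is almost everywhere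
  finite because \<open>L\<close> is sigma-finite, so \<open>enn2real\<close> changes it only on a
  null set and yields the real-valued density that \<open>is_density\<close> asks for.\<close>

lemma is_density_exists:
  assumes "sigma_finite_measure \<nu>" "sigma_finite_measure L" and sets: "sets L = sets \<nu>"
    and le: "\<And>B. B \<in> sets \<nu> \<Longrightarrow> emeasure L B \<le> emeasure \<nu> B"
  shows "\<exists>f. is_density \<nu> L f"
proof -
  interpret sigma_finite_measure \<nu> by fact
  have ac: "absolutely_continuous \<nu> L"
    unfolding absolutely_continuous_def null_sets_def
    using le sets by (auto simp: le_zero_eq) (metis le_zero_eq)
  have fin: "AE x in \<nu>. RN_deriv \<nu> L x \<noteq> \<infinity>"
    using RN_deriv_finite[OF assms(2) ac sets] .
  have "density \<nu> (\<lambda>x. ennreal (enn2real (RN_deriv \<nu> L x))) = density \<nu> (RN_deriv \<nu> L)"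
    using fin by (intro density_cong) (auto simp: less_top)
  also have "\<dots> = L" by (rule density_RN_deriv[OF ac sets])
  finally show ?thesis
    unfolding is_density_def by (intro exI[of _ "\<lambda>x. enn2real (RN_deriv \<nu> L x)"]) auto
qed

section \<open>Poisson distributions\<close>

text \<open>With rate 0 included, the usual mass formula, read with \<open>0 ^ 0 = 1\<close>, covers
  all finite means.\<close>

definition poisson_pmf0 :: "real \<Rightarrow> nat pmf" where
  "poisson_pmf0 r = (if r = 0 then return_pmf 0 else poisson_pmf r)"

lemma pmf_poisson_pmf0: "r \<ge> 0 \<Longrightarrow> pmf (poisson_pmf0 r) k = r ^ k / fact k * exp (- r)"
  by (auto simp: poisson_pmf0_def indicator_def)

lemma poisson_distribution_ennreal:
  assumes "r \<ge> 0"
  shows "poisson_distribution (ennreal r) = distr (measure_pmf (poisson_pmf0 r)) borel of_nat"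
proof (cases "r = 0")
  case True
  have "distr (measure_pmf (return_pmf 0)) borel (of_nat :: nat \<Rightarrow> ennreal) = return borel 0"
    by (simp add: return_pmf.rep_eq) (subst distr_return, auto)
  then show ?thesis using True by (simp add: poisson_distribution_def poisson_pmf0_def)
qed (use assms in \<open>auto simp: poisson_distribution_def poisson_pmf0_def\<close>)

lemma sets_poisson_distribution [simp, measurable_cong]: "sets (poisson_distribution r) = sets borel"
  by (simp add: poisson_distribution_def)

lemma space_poisson_distribution [simp]: "space (poisson_distribution r) = UNIV"
  by (simp add: poisson_distribution_def)

lemma prob_space_poisson_distribution: "prob_space (poisson_distribution r)"
  by (auto simp: poisson_distribution_def intro!: prob_space_return measure_pmf.prob_space_distr)

text \<open>The mass at \<open>n\<close> is a sum over the splittings \<open>k + (n - k)\<close>,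
  which the binomial theorem evaluates.\<close>

lemma poisson_pmf0_add:
  assumes "a \<ge> 0" "b \<ge> 0"
  shows "map_pmf (\<lambda>(x, y). x + y) (pair_pmf (poisson_pmf0 a) (poisson_pmf0 b)) = poisson_pmf0 (a + b)"
proof (rule pmf_eqI)
  fix n :: nat
  let ?A = "(\<lambda>k. (k, n - k)) ` {..n}"
  have "pmf (map_pmf (\<lambda>(x, y). x + y) (pair_pmf (poisson_pmf0 a) (poisson_pmf0 b))) n
      = measure (pair_pmf (poisson_pmf0 a) (poisson_pmf0 b)) ((\<lambda>(x, y). x + y) -` {n})"
    by (simp add: pmf_map)
  also have "(\<lambda>(x, y). x + y) -` {n} = ?A" by (auto simp: image_iff)
  also have "measure (pair_pmf (poisson_pmf0 a) (poisson_pmf0 b)) ?A =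
      (\<Sum>z\<in>?A. pmf (pair_pmf (poisson_pmf0 a) (poisson_pmf0 b)) z)"
    by (rule measure_measure_pmf_finite) simp
  also have "\<dots> = (\<Sum>k\<le>n. pmf (poisson_pmf0 a) k * pmf (poisson_pmf0 b) (n - k))"
    by (subst sum.reindex) (auto simp: inj_on_def pmf_pair)
  also have "\<dots> = (\<Sum>k\<le>n. (of_nat (n choose k) * a ^ k * b ^ (n - k)) * (exp (- (a + b)) / fact n))"
    using assms
    by (intro sum.cong refl)
       (auto simp: pmf_poisson_pmf0 binomial_fact field_simps exp_add[symmetric])
  also have "\<dots> = (a + b) ^ n * (exp (- (a + b)) / fact n)"
    by (simp add: binomial_ring sum_distrib_right sum_divide_distrib)
  also have "\<dots> = pmf (poisson_pmf0 (a + b)) n"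
    using assms by (simp add: pmf_poisson_pmf0)
  finally show "pmf (map_pmf (\<lambda>(x, y). x + y) (pair_pmf (poisson_pmf0 a) (poisson_pmf0 b))) n
      = pmf (poisson_pmf0 (a + b)) n" .
qed

lemma nn_integral_poisson_distribution:
  fixes F :: "ennreal \<Rightarrow> ennreal"
  assumes "F \<in> borel_measurable borel" "r \<ge> 0"
  shows "(\<integral>\<^sup>+x. F x \<partial>poisson_distribution (ennreal r)) = (\<integral>\<^sup>+k. F (of_nat k) \<partial>poisson_pmf0 r)"
  using assms by (simp add: poisson_distribution_ennreal nn_integral_distr)

text \<open>Additivity of independent Poisson variables, as the iterated integral in which it arises
  for superpositions. An infinite mean is absorbing on both sides; finite means reduce to the
  convolution of mass functions.\<close>

lemma poisson_distribution_add:
  assumes "E \<in> sets borel"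
  shows "(\<integral>\<^sup>+x. \<integral>\<^sup>+y. indicator E (x + y) \<partial>poisson_distribution b \<partial>poisson_distribution a)
    = emeasure (poisson_distribution (a + b)) E"
proof -
  note [measurable] = assms
  interpret a: prob_space "poisson_distribution a" by (rule prob_space_poisson_distribution)
  interpret b: prob_space "poisson_distribution b" by (rule prob_space_poisson_distribution)
  consider "a = \<infinity>" | "b = \<infinity>" | "a \<noteq> \<infinity>" "b \<noteq> \<infinity>" by blast
  then show ?thesis
  proof cases
    case 1
    have "(\<lambda>x. \<integral>\<^sup>+y. indicator E (x + y) \<partial>poisson_distribution b) \<in> borel_measurable borel"
      by measurable
    moreover have "poisson_distribution a = return borel \<infinity>" "poisson_distribution (a + b) = return borel \<infinity>"
      using 1 by (auto simp: poisson_distribution_def)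
    ultimately show ?thesis
      using b.emeasure_space_1 by (simp add: nn_integral_return)
  next
    case 2
    then show ?thesis
      using a.emeasure_space_1 by (simp add: poisson_distribution_def nn_integral_return)
  next
    case 3
    then obtain u v where uv: "a = ennreal u" "b = ennreal v" "u \<ge> 0" "v \<ge> 0"
      by (metis ennreal_cases infinity_ennreal_def)
    have "(\<integral>\<^sup>+x. \<integral>\<^sup>+y. indicator E (x + y) \<partial>poisson_distribution b \<partial>poisson_distribution a)
      = (\<integral>\<^sup>+j. \<integral>\<^sup>+k. indicator E (of_nat j + of_nat k) \<partial>poisson_pmf0 v \<partial>poisson_pmf0 u)"
      unfolding uv using uv
      by (subst nn_integral_poisson_distribution) (auto simp: nn_integral_poisson_distribution)
    also have "\<dots> = (\<integral>\<^sup>+z. indicator E (of_nat (case z of (x, y) \<Rightarrow> x + y)) \<partial>pair_pmf (poisson_pmf0 u) (poisson_pmf0 v))"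
      by (simp add: nn_integral_pair_pmf')
    also have "\<dots> = (\<integral>\<^sup>+k. indicator E (of_nat k) \<partial>poisson_pmf0 (u + v))"
      using uv by (simp add: poisson_pmf0_add[symmetric] del: of_nat_add)
    also have "\<dots> = (\<integral>\<^sup>+x. indicator E x \<partial>poisson_distribution (ennreal (u + v)))"
      using uv by (subst nn_integral_poisson_distribution) auto
    also have "\<dots> = emeasure (poisson_distribution (a + b)) E"
      using uv by simp
    finally show ?thesis .
  qed
qed

text \<open>The junk value \<open>natval \<infinity> = 0\<close> is harmless: \<open>unit_poisson\<close> is carried by the finite integers.\<close>

definition natval :: "ennreal \<Rightarrow> nat" where
  "natval x = nat \<lfloor>enn2real x\<rfloor>"

lemma natval_of_nat [simp]: "natval (of_nat k) = k"
  by (simp add: natval_def flip: ennreal_of_nat_eq_real_of_nat)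

lemma measurable_natval [measurable]: "natval \<in> borel \<rightarrow>\<^sub>M count_space UNIV"
  unfolding natval_def by measurable

section \<open>Densities with respect to the Poisson law of mean 1\<close>

text \<open>A common reference law: it charges every natural number, hence dominates the Poisson
  laws of all finite means, including mean 0.\<close>

abbreviation unit_poisson :: "ennreal measure" where
  "unit_poisson \<equiv> poisson_distribution 1"

text \<open>The probability generating function of the unit Poisson law at \<open>a\<close>,
  obtained from the exponential series.\<close>

lemma nn_integral_unit_poisson_geometric:
  fixes K a :: real
  assumes "K \<ge> 0" "a \<ge> 0"
  shows "(\<integral>\<^sup>+x. ennreal (K * a ^ natval x) \<partial>unit_poisson) = ennreal (K * exp (a - 1))"
proof -
  have s: "(\<lambda>k. (K * exp (-1)) * (a ^ k / fact k)) sums ((K * exp (-1)) * exp a)"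
    using exp_converges[of a] by (intro sums_mult) (simp add: field_simps scaleR_conv_of_real)
  have "(\<integral>\<^sup>+x. ennreal (K * a ^ natval x) \<partial>unit_poisson) = (\<integral>\<^sup>+k. ennreal (K * a ^ k) \<partial>poisson_pmf0 1)"
    using nn_integral_poisson_distribution[of "\<lambda>x. ennreal (K * a ^ natval x)" 1] by simp
  also have "\<dots> = (\<Sum>k. ennreal ((K * exp (-1)) * (a ^ k / fact k)))"
    using assms
    by (simp add: nn_integral_measure_pmf nn_integral_count_space_nat pmf_poisson_pmf0 field_simps
        flip: ennreal_mult)
  also have "\<dots> = ennreal ((K * exp (-1)) * exp a)"
    using s assms by (intro suminf_ennreal_eq) auto
  also have "(K * exp (-1)) * exp a = K * exp (a - 1)"
    by (simp add: exp_diff exp_minus field_simps)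
  finally show ?thesis .
qed

text \<open>Quotient of the Poisson masses of rates \<open>r\<close> and 1, in which the factorials
  cancel.\<close>

definition poisson_density :: "real \<Rightarrow> ennreal \<Rightarrow> real" where
  "poisson_density r x = exp (1 - r) * r ^ natval x"

lemma measurable_poisson_density [measurable]: "poisson_density r \<in> borel_measurable borel"
  unfolding poisson_density_def by measurable

lemma poisson_density_nonneg [simp]: "r \<ge> 0 \<Longrightarrow> poisson_density r x \<ge> 0"
  by (simp add: poisson_density_def)

lemma poisson_distribution_eq_density:
  assumes "r \<ge> 0"
  shows "poisson_distribution (ennreal r) = density unit_poisson (\<lambda>x. ennreal (poisson_density r x))"
proof (rule measure_eqI)
  fix E :: "ennreal set" assume "E \<in> sets (poisson_distribution (ennreal r))"
  then have [measurable]: "E \<in> sets borel" by simp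
  have "emeasure (poisson_distribution (ennreal r)) E = (\<integral>\<^sup>+k. indicator E (of_nat k) \<partial>poisson_pmf0 r)"
    using nn_integral_poisson_distribution[of "indicator E" r] assms by simp
  also have "\<dots> = (\<integral>\<^sup>+k. ennreal (poisson_density r (of_nat k)) * indicator E (of_nat k) \<partial>poisson_pmf0 1)"
    using assms unfolding nn_integral_measure_pmf
    by (intro nn_integral_cong)
       (auto simp: pmf_poisson_pmf0 poisson_density_def exp_diff exp_minus field_simps
        split: split_indicator simp flip: ennreal_mult)
  also have "\<dots> = emeasure (density unit_poisson (\<lambda>x. ennreal (poisson_density r x))) E"
    using nn_integral_poisson_distribution[of "\<lambda>x. ennreal (poisson_density r x) * indicator E x" 1]
    by (simp add: emeasure_density)
  finally show "emeasure (poisson_distribution (ennreal r)) E =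
    emeasure (density unit_poisson (\<lambda>x. ennreal (poisson_density r x))) E" .
qed simp

section \<open>Joint law of the counts\<close>

text \<open>\<open>poisson_PP\<close> grants independence for the index sets \<open>{1..n}\<close>
  only; this carries it to families indexed otherwise, such as families of sets indexed by
  themselves.\<close>

lemma (in prob_space) indep_vars_reindex_bij:
  assumes "indep_vars (\<lambda>k. M' (h k)) (\<lambda>k. X (h k)) K" and h: "bij_betw h K I"
  shows "indep_vars M' X I"
proof -
  have inj: "inj_on h K" and img: "h ` K = I" using h by (auto simp: bij_betw_def)
  note iv = assms(1)[unfolded indep_vars_def2 indep_sets_def]
  show ?thesis
    unfolding indep_vars_def2 indep_sets_def
  proof (intro conjI ballI allI impI)
    fix i assume "i \<in> I"
    then show "random_variable (M' i) (X i)"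
      "{X i -` A \<inter> space M |A. A \<in> sets (M' i)} \<subseteq> events" using iv img by auto
  next
    fix J A assume J: "J \<subseteq> I" "J \<noteq> {}" "finite J"
      and A: "A \<in> (\<Pi> i\<in>J. {X i -` A \<inter> space M |A. A \<in> sets (M' i)})"
    define J' where "J' = {k \<in> K. h k \<in> J}"
    have hJ: "h ` J' = J" using J img by (auto simp: J'_def)
    have injJ: "inj_on h J'" using inj by (rule inj_on_subset) (auto simp: J'_def)
    have J': "J' \<subseteq> K" "J' \<noteq> {}" "finite J'"
      using J hJ finite_imageD[OF _ injJ] by (auto simp: J'_def)
    have "(\<lambda>k. A (h k)) \<in> (\<Pi> k\<in>J'. {X (h k) -` A \<inter> space M |A. A \<in> sets (M' (h k))})"
    proof (rule Pi_I)
      fix k assume "k \<in> J'"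
      then have "h k \<in> J" by (simp add: J'_def)
      then show "A (h k) \<in> {X (h k) -` A \<inter> space M |A. A \<in> sets (M' (h k))}"
        using A by (rule Pi_mem[rotated])
    qed
    then have "prob (\<Inter>k\<in>J'. A (h k)) = (\<Prod>k\<in>J'. prob (A (h k)))"
      using iv J' by blast
    then show "prob (\<Inter>j\<in>J. A j) = (\<Prod>j\<in>J. prob (A j))"
      using prod.reindex[OF injJ, of "\<lambda>i. prob (A i)"] image_image[of A h J'] by (simp add: hJ)
  qed
qed

lemma prod_indicator_PiE:
  assumes "finite I" "x \<in> extensional I"
  shows "indicator (Pi\<^sub>E I A) x = (\<Prod>i\<in>I. indicator (A i) (x i) :: ennreal)"
proof (cases "\<forall>i\<in>I. x i \<in> A i")
  case True then show ?thesis using assms by (simp add: PiE_iff)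
next
  case False
  then obtain i where i: "i \<in> I" "x i \<notin> A i" by blast
  then have "(\<Prod>i\<in>I. indicator (A i) (x i) :: ennreal) = 0"
    using assms i by (intro prod_zero bexI[of _ i]) auto
  moreover have "x \<notin> Pi\<^sub>E I A" using i by auto
  ultimately show ?thesis by simp
qed

text \<open>Both measures agree on boxes, where independence turns the integral of a product of
  indicators into a product. Off \<open>I\<close> a Dirac law stands in, because \<open>X i\<close>
  is measurable only for \<open>i \<in> I\<close> while the product space wants a probability at
  every index.\<close>

lemma (in prob_space) distr_indep_vars_eq_PiM:
  fixes X :: "'i \<Rightarrow> 'a \<Rightarrow> ennreal"
  assumes I: "finite I" and iv: "indep_vars (\<lambda>_. borel) X I"
  shows "distr M (Pi\<^sub>M I (\<lambda>_. borel)) (\<lambda>\<omega>. \<lambda>i\<in>I. X i \<omega>) =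
    Pi\<^sub>M I (\<lambda>i. if i \<in> I then distr M borel (X i) else return borel 0)"
proof -
  have rv[measurable]: "X i \<in> borel_measurable M" if "i \<in> I" for i
    using iv that by (auto simp: indep_vars_def2)
  define N where "N i = (if i \<in> I then distr M borel (X i) else return borel 0)" for i
  have N: "prob_space (N i)" for i
    by (auto simp: N_def intro: prob_space_distr prob_space_return)
  interpret N: product_prob_space N by (rule product_prob_spaceI) (rule N)
  have sN: "sets (N i) = sets borel" for i by (simp add: N_def)
  have "distr M (Pi\<^sub>M I (\<lambda>_. borel)) (\<lambda>\<omega>. \<lambda>i\<in>I. X i \<omega>) = Pi\<^sub>M I N"
  proof (rule N.PiM_eqI)
    show "sets (distr M (Pi\<^sub>M I (\<lambda>_. borel)) (\<lambda>\<omega>. \<lambda>i\<in>I. X i \<omega>)) = sets (Pi\<^sub>M I N)"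
      by (simp add: sN cong: sets_PiM_cong)
  next
    fix A assume A: "\<And>i. i \<in> I \<Longrightarrow> A i \<in> sets (N i)"
    then have A': "\<And>i. i \<in> I \<Longrightarrow> A i \<in> sets borel" by (simp add: sN)
    have "emeasure (distr M (Pi\<^sub>M I (\<lambda>_. borel)) (\<lambda>\<omega>. \<lambda>i\<in>I. X i \<omega>)) (Pi\<^sub>E I A)
      = (\<integral>\<^sup>+\<omega>. indicator (Pi\<^sub>E I A) (\<lambda>i\<in>I. X i \<omega>) \<partial>M)"
      using A' I by (intro emeasure_distr_nn_integral measurable_restrict sets_PiM_I_finite) auto
    also have "\<dots> = (\<integral>\<^sup>+\<omega>. (\<Prod>i\<in>I. indicator (A i) (X i \<omega>)) \<partial>M)"
    proof (rule nn_integral_cong)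
      fix \<omega>
      show "indicator (Pi\<^sub>E I A) (\<lambda>i\<in>I. X i \<omega>) = (\<Prod>i\<in>I. indicator (A i) (X i \<omega>) :: ennreal)"
        using I by (simp add: prod_indicator_PiE)
    qed
    also have "\<dots> = (\<Prod>i\<in>I. \<integral>\<^sup>+\<omega>. indicator (A i) (X i \<omega>) \<partial>M)"
      using A' by (intro indep_vars_nn_integral I indep_vars_compose2[OF iv]) auto
    also have "\<dots> = (\<Prod>i\<in>I. emeasure (N i) (A i))"
    proof (rule prod.cong)
      fix i assume i: "i \<in> I"
      then show "(\<integral>\<^sup>+\<omega>. indicator (A i) (X i \<omega>) \<partial>M) = emeasure (N i) (A i)"
        using A'[OF i] by (simp add: N_def emeasure_distr_nn_integral)
    qed simp
    finally show "emeasure (distr M (Pi\<^sub>M I (\<lambda>_. borel)) (\<lambda>\<omega>. \<lambda>i\<in>I. X i \<omega>)) (Pi\<^sub>E I A) =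
      (\<Prod>i\<in>I. emeasure (N i) (A i))" .
  qed (rule I)
  then show ?thesis by (simp add: N_def[abs_def])
qed

text \<open>On a box the integral of the product density factorises, and boxes determine a product
  of sigma-finite measures.\<close>

lemma PiM_density_prod:
  fixes f :: "'i \<Rightarrow> 'b \<Rightarrow> ennreal"
  assumes I: "finite I" and N: "\<And>i. sigma_finite_measure (N i)"
    and f: "\<And>i. f i \<in> borel_measurable (N i)" and Nf: "\<And>i. sigma_finite_measure (density (N i) (f i))"
  shows "density (Pi\<^sub>M I N) (\<lambda>x. \<Prod>i\<in>I. f i (x i)) = Pi\<^sub>M I (\<lambda>i. density (N i) (f i))"
proof -
  note f[measurable]
  interpret N: product_sigma_finite N by (rule product_sigma_finite.intro) (rule N)
  interpret D: product_sigma_finite "\<lambda>i. density (N i) (f i)" by (rule product_sigma_finite.intro) (rule Nf)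
  show ?thesis
  proof (rule D.PiM_eqI)
    fix A assume A: "\<And>i. i \<in> I \<Longrightarrow> A i \<in> sets (density (N i) (f i))"
    have "emeasure (density (Pi\<^sub>M I N) (\<lambda>x. \<Prod>i\<in>I. f i (x i))) (Pi\<^sub>E I A)
      = (\<integral>\<^sup>+x. (\<Prod>i\<in>I. f i (x i)) * indicator (Pi\<^sub>E I A) x \<partial>Pi\<^sub>M I N)"
      using A I by (subst emeasure_density) (auto intro!: sets_PiM_I_finite)
    also have "\<dots> = (\<integral>\<^sup>+x. (\<Prod>i\<in>I. f i (x i) * indicator (A i) (x i)) \<partial>Pi\<^sub>M I N)"
    proof (rule nn_integral_cong)
      fix x assume "x \<in> space (Pi\<^sub>M I N)"
      then have "x \<in> extensional I" by (auto simp: space_PiM PiE_iff)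
      then show "(\<Prod>i\<in>I. f i (x i)) * indicator (Pi\<^sub>E I A) x = (\<Prod>i\<in>I. f i (x i) * indicator (A i) (x i))"
        using I by (auto simp: prod.distrib prod_indicator_PiE)
    qed
    also have "\<dots> = (\<Prod>i\<in>I. \<integral>\<^sup>+x. f i x * indicator (A i) x \<partial>N i)"
      using A I by (intro N.product_nn_integral_prod) auto
    also have "\<dots> = (\<Prod>i\<in>I. emeasure (density (N i) (f i)) (A i))"
      using A by (intro prod.cong) (auto simp: emeasure_density)
    finally show "emeasure (density (Pi\<^sub>M I N) (\<lambda>x. \<Prod>i\<in>I. f i (x i))) (Pi\<^sub>E I A)
      = (\<Prod>i\<in>I. emeasure (density (N i) (f i)) (A i))" .
  qed (use I in \<open>auto cong: sets_PiM_cong\<close>)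
qed

section \<open>The joint density of the counts of a Poisson process\<close>

text \<open>Enumerating \<open>I\<close> reduces to the defining clause of
  \<open>poisson_PP\<close>; the empty family is separate since that clause begins at
  \<open>n = 1\<close>.\<close>

lemma poisson_PP_indep_vars:
  fixes D :: "'i \<Rightarrow> 'a set"
  assumes PP: "poisson_PP S L P" and I: "finite I" "\<And>i. i \<in> I \<Longrightarrow> D i \<in> sets S" "disjoint_family_on D I"
  shows "prob_space.indep_vars P (\<lambda>_. borel) (\<lambda>i \<eta>. emeasure \<eta> (D i)) I"
proof -
  interpret prob_space P using PP by (simp add: poisson_PP_def)
  show ?thesis
  proof (cases "I = {}")
    case True then show ?thesis by (auto simp: indep_vars_def2 indep_sets_def)
  next
    case False
    obtain h where h: "bij_betw h {1..card I} I" using I ex_bij_betw_nat_finite_1 by blast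
    then have hI: "h k \<in> I" if "k \<in> {1..card I}" for k using that by (auto simp: bij_betw_def)
    have "card I \<ge> 1" using False I by (simp add: Suc_le_eq card_gt_0_iff)
    moreover have "\<forall>k\<in>{1..card I}. D (h k) \<in> sets S" using hI I by blast
    moreover have "disjoint_family_on (\<lambda>k. D (h k)) {1..card I}"
      unfolding disjoint_family_on_def
    proof (intro ballI impI)
      fix m n assume mn: "m \<in> {1..card I}" "n \<in> {1..card I}" "m \<noteq> n"
      then have "h m \<noteq> h n" using h by (metis bij_betw_def inj_onD)
      then show "D (h m) \<inter> D (h n) = {}" using I(3) hI mn by (simp add: disjoint_family_on_def)
    qed
    ultimately have "indep_vars (\<lambda>_. borel) (\<lambda>k \<eta>. emeasure \<eta> (D (h k))) {1..card I}"
      using PP by (simp add: poisson_PP_def)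
    then show ?thesis using h by (intro indep_vars_reindex_bij[where h = h]) auto
  qed
qed

text \<open>The index set may itself be a family of sets, with \<open>D = id\<close>; cylinder
  events use it in this way.\<close>

definition counts :: "'i set \<Rightarrow> ('i \<Rightarrow> 'a set) \<Rightarrow> 'a measure \<Rightarrow> 'i \<Rightarrow> ennreal" where
  "counts I D \<eta> = (\<lambda>i\<in>I. emeasure \<eta> (D i))"

lemma measurable_counts:
  assumes "\<And>i. i \<in> I \<Longrightarrow> D i \<in> sets S"
  shows "counts I D \<in> point_pattern_space S \<rightarrow>\<^sub>M Pi\<^sub>M I (\<lambda>_. borel)"
  unfolding counts_def using assms
  by (intro measurable_restrict measurable_emeasure_point_pattern_space)

text \<open>Independence makes the law a product of Poisson laws. Finite means are essential: the
  law of mean \<infinity> sits at \<infinity>, which \<open>unit_poisson\<close> does not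
  charge.\<close>

lemma distr_counts:
  fixes D :: "'i \<Rightarrow> 'a set"
  assumes PP: "poisson_PP S L P" and I: "finite I" "\<And>i. i \<in> I \<Longrightarrow> D i \<in> sets S" "disjoint_family_on D I"
    and fin: "\<And>i. i \<in> I \<Longrightarrow> emeasure L (D i) < \<infinity>"
  shows "distr P (Pi\<^sub>M I (\<lambda>_. borel)) (counts I D) =
    density (Pi\<^sub>M I (\<lambda>_. unit_poisson)) (\<lambda>x. ennreal (\<Prod>i\<in>I. poisson_density (measure L (D i)) (x i)))"
proof -
  interpret prob_space P using PP by (simp add: poisson_PP_def)
  have N: "prob_space (density unit_poisson (\<lambda>x. ennreal (poisson_density (measure L (D i)) x)))" for i
    using poisson_distribution_eq_density[of "measure L (D i)"] prob_space_poisson_distribution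
    by (metis measure_nonneg)
  have "distr P (Pi\<^sub>M I (\<lambda>_. borel)) (counts I D) =
    Pi\<^sub>M I (\<lambda>i. if i \<in> I then distr P borel (\<lambda>\<eta>. emeasure \<eta> (D i)) else return borel 0)"
    unfolding counts_def by (intro distr_indep_vars_eq_PiM I poisson_PP_indep_vars[OF PP])
  also have "\<dots> = Pi\<^sub>M I (\<lambda>i. density unit_poisson (\<lambda>x. ennreal (poisson_density (measure L (D i)) x)))"
  proof (rule PiM_cong)
    fix i assume i: "i \<in> I"
    have "emeasure L (D i) = ennreal (measure L (D i))"
      using fin[OF i] by (simp add: emeasure_eq_ennreal_measure)
    then show "(if i \<in> I then distr P borel (\<lambda>\<eta>. emeasure \<eta> (D i)) else return borel 0)
      = density unit_poisson (\<lambda>x. ennreal (poisson_density (measure L (D i)) x))"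
      using PP i I poisson_distribution_eq_density[of "measure L (D i)"] by (simp add: poisson_PP_def)
  qed simp
  also have "\<dots> = density (Pi\<^sub>M I (\<lambda>_. unit_poisson)) (\<lambda>x. \<Prod>i\<in>I. ennreal (poisson_density (measure L (D i)) (x i)))"
    by (intro PiM_density_prod[symmetric] I prob_space_imp_sigma_finite N prob_space_poisson_distribution)
       simp
  finally show ?thesis by (simp add: prod_ennreal)
qed

text \<open>The one integral behind both the second moment of the density ratio and the affinity:
  each integrand is a product over cells of terms \<open>K * a ^ k\<close>.\<close>

lemma nn_integral_PiM_unit_poisson_geometric:
  fixes K a :: "'i \<Rightarrow> real"
  assumes I: "finite I" and "\<And>i. K i \<ge> 0" "\<And>i. a i \<ge> 0"
  shows "(\<integral>\<^sup>+x. ennreal (\<Prod>i\<in>I. K i * a i ^ natval (x i)) \<partial>Pi\<^sub>M I (\<lambda>_. unit_poisson))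
    = ennreal (\<Prod>i\<in>I. K i * exp (a i - 1))"
proof -
  interpret product_sigma_finite "\<lambda>_. unit_poisson"
    by (intro product_sigma_finite.intro prob_space_imp_sigma_finite prob_space_poisson_distribution)
  have "(\<integral>\<^sup>+x. ennreal (\<Prod>i\<in>I. K i * a i ^ natval (x i)) \<partial>Pi\<^sub>M I (\<lambda>_. unit_poisson))
    = (\<integral>\<^sup>+x. (\<Prod>i\<in>I. ennreal (K i * a i ^ natval (x i))) \<partial>Pi\<^sub>M I (\<lambda>_. unit_poisson))"
    using assms by (simp add: prod_ennreal)
  also have "\<dots> = (\<Prod>i\<in>I. \<integral>\<^sup>+x. ennreal (K i * a i ^ natval x) \<partial>unit_poisson)"
    by (rule product_nn_integral_prod) (use I in auto)
  also have "\<dots> = ennreal (\<Prod>i\<in>I. K i * exp (a i - 1))"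
    using assms by (simp add: nn_integral_unit_poisson_geometric prod_ennreal)
  finally show ?thesis .
qed

section \<open>Comparison of the counts of two Poisson processes\<close>

locale poisson_cells =
  fixes S L P and I :: "'i set" and D :: "'i \<Rightarrow> 'a set"
  assumes PP: "poisson_PP S L P" and I: "finite I" "\<And>i. i \<in> I \<Longrightarrow> D i \<in> sets S" "disjoint_family_on D I"
    and fin: "\<And>i. i \<in> I \<Longrightarrow> emeasure L (D i) < \<infinity>"
begin

sublocale prob_space P using PP by (simp add: poisson_PP_def)

definition pdens :: "('i \<Rightarrow> ennreal) \<Rightarrow> real" where
  "pdens x = (\<Prod>i\<in>I. poisson_density (measure L (D i)) (x i))"

lemma measurable_pdens [measurable]: "pdens \<in> borel_measurable (Pi\<^sub>M I (\<lambda>_. unit_poisson))"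
  unfolding pdens_def by measurable

lemma pdens_nonneg [simp]: "pdens x \<ge> 0"
  by (simp add: pdens_def prod_nonneg)

lemma space_P: "space P = point_patterns S"
  using PP by (metis poisson_PP_def sets_eq_imp_space_eq space_point_pattern_space)

lemma measurable_counts_P: "counts I D \<in> P \<rightarrow>\<^sub>M Pi\<^sub>M I (\<lambda>_. borel)"
  using PP measurable_counts[OF I(2)] by (simp add: poisson_PP_def cong: measurable_cong_sets)

lemma prob_counts:
  assumes E: "E \<in> sets (Pi\<^sub>M I (\<lambda>_. borel))"
  shows "ennreal (prob (counts I D -` E \<inter> space P))
    = (\<integral>\<^sup>+x. ennreal (pdens x) * indicator E x \<partial>Pi\<^sub>M I (\<lambda>_. unit_poisson))"
proof -
  have E': "E \<in> sets (Pi\<^sub>M I (\<lambda>_. unit_poisson))" using E by (simp cong: sets_PiM_cong)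
  have d: "distr P (Pi\<^sub>M I (\<lambda>_. borel)) (counts I D) = density (Pi\<^sub>M I (\<lambda>_. unit_poisson)) (\<lambda>x. ennreal (pdens x))"
    unfolding pdens_def by (rule distr_counts[OF PP I fin])
  have "emeasure P (counts I D -` E \<inter> space P) = emeasure (distr P (Pi\<^sub>M I (\<lambda>_. borel)) (counts I D)) E"
    using E by (subst emeasure_distr[OF measurable_counts_P]) auto
  also have "\<dots> = (\<integral>\<^sup>+x. ennreal (pdens x) * indicator E x \<partial>Pi\<^sub>M I (\<lambda>_. unit_poisson))"
    using E' unfolding d by (subst emeasure_density) auto
  finally show ?thesis by (simp add: emeasure_eq_measure)
qed

end

locale two_poisson_cells = P: poisson_cells S L P I D + Q: poisson_cells S X Q I D
  for S L P X Q and I :: "'i set" and D :: "'i \<Rightarrow> 'a set"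
begin

abbreviation "l i \<equiv> measure L (D i)"
abbreviation "m i \<equiv> measure X (D i)"

lemma spaces_eq: "space P = space Q"
  by (simp add: P.space_P Q.space_P)

text \<open>The ratio \<open>s\<close> of the two densities satisfies \<open>s \<le> t + s\<^sup>2 / t\<close>, and its second moment
  factorises over the cells into the exponential on the right.\<close>

lemma prob_le_chi_square:
  assumes le: "\<And>i. i \<in> I \<Longrightarrow> l i \<le> m i" and t: "t > 0"
    and E: "E \<in> sets (Pi\<^sub>M I (\<lambda>_. borel))"
  shows "P.prob (counts I D -` E \<inter> space P)
    \<le> t * Q.prob (counts I D -` E \<inter> space P) + exp (\<Sum>i\<in>I. (m i - l i)\<^sup>2 / m i) / t"
proof -
  let ?C = "Pi\<^sub>M I (\<lambda>_. unit_poisson)"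
  have E'[measurable]: "E \<in> sets ?C" using E by (simp cong: sets_PiM_cong)
  \<comment> \<open>The ratio of the two joint densities. If \<open>m i = 0\<close> then
    \<open>l i = 0\<close> as well, and the default \<open>0 / 0 = 0\<close> is harmless: both
    densities then vanish except at count 0.\<close>
  define s where "s x = (\<Prod>i\<in>I. exp (m i - l i) * (l i / m i) ^ natval (x i))" for x
  \<comment> \<open>This is \<open>s\<close> squared times the density of \<open>Q\<close>, written
    in the form \<open>K * a ^ k\<close> so that its integral is explicit.\<close>
  define w where "w x = (\<Prod>i\<in>I. exp (1 + m i - 2 * l i) * ((l i)\<^sup>2 / m i) ^ natval (x i))" for x
  have w[measurable]: "w \<in> borel_measurable ?C" unfolding w_def by measurable
  have s0: "s x \<ge> 0" and w0: "w x \<ge> 0" for x by (auto simp: s_def w_def intro!: prod_nonneg)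
  have p: "P.pdens x = s x * Q.pdens x" for x
    unfolding P.pdens_def Q.pdens_def s_def prod.distrib[symmetric]
  proof (rule prod.cong)
    fix i assume "i \<in> I"
    then have "m i = 0 \<Longrightarrow> l i = 0" using le[of i] measure_nonneg[of L "D i"] by linarith
    then show "poisson_density (l i) (x i) =
        exp (m i - l i) * (l i / m i) ^ natval (x i) * poisson_density (m i) (x i)"
      by (cases "m i = 0")
         (auto simp: poisson_density_def power_divide exp_diff field_simps power_0_left)
  qed simp
  have w_eq: "w x = s x * s x * Q.pdens x" for x
    unfolding Q.pdens_def s_def w_def prod.distrib[symmetric]
  proof (rule prod.cong)
    fix i assume "i \<in> I"
    then have "m i = 0 \<Longrightarrow> l i = 0" using le[of i] measure_nonneg[of L "D i"] by linarith
    moreover have "exp (1 + m i - 2 * l i) = exp (m i - l i) * exp (m i - l i) * exp (1 - m i)"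
      by (simp flip: exp_add)
    ultimately show "exp (1 + m i - 2 * l i) * ((l i)\<^sup>2 / m i) ^ natval (x i) =
        exp (m i - l i) * (l i / m i) ^ natval (x i) * (exp (m i - l i) * (l i / m i) ^ natval (x i)) *
        poisson_density (m i) (x i)"
      by (cases "m i = 0")
         (auto simp: poisson_density_def power_divide power2_eq_square power_mult_distrib power_0_left)
  qed simp
  have "ennreal (P.prob (counts I D -` E \<inter> space P)) = (\<integral>\<^sup>+x. ennreal (P.pdens x) * indicator E x \<partial>?C)"
    by (rule P.prob_counts[OF E])
  also have "\<dots> \<le> (\<integral>\<^sup>+x. ennreal t * (ennreal (Q.pdens x) * indicator E x) + ennreal (1 / t) * ennreal (w x) \<partial>?C)"
  proof (rule nn_integral_mono)
    fix x
    have "0 \<le> (s x - t)\<^sup>2 + s x * t" using s0[of x] t by simp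
    then have "s x * t \<le> t * t + s x * s x" by (simp add: power2_eq_square algebra_simps)
    then have "s x \<le> t + (1 / t) * (s x * s x)" using t by (simp add: field_simps)
    then have "s x * Q.pdens x \<le> (t + (1 / t) * (s x * s x)) * Q.pdens x"
      by (rule mult_right_mono) simp
    then have "P.pdens x \<le> t * Q.pdens x + (1 / t) * w x"
      unfolding p w_eq by (simp add: algebra_simps)
    then have "ennreal (P.pdens x) \<le> ennreal t * ennreal (Q.pdens x) + ennreal (1 / t) * ennreal (w x)"
      using t w0[of x] by (simp flip: ennreal_mult ennreal_plus)
    then show "ennreal (P.pdens x) * indicator E x
      \<le> ennreal t * (ennreal (Q.pdens x) * indicator E x) + ennreal (1 / t) * ennreal (w x)"
      by (auto split: split_indicator)
  qed
  also have "\<dots> = ennreal t * (\<integral>\<^sup>+x. ennreal (Q.pdens x) * indicator E x \<partial>?C) + ennreal (1 / t) * (\<integral>\<^sup>+x. ennreal (w x) \<partial>?C)"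
    by (subst nn_integral_add) (auto simp: nn_integral_cmult)
  also have "(\<integral>\<^sup>+x. ennreal (Q.pdens x) * indicator E x \<partial>?C) = ennreal (Q.prob (counts I D -` E \<inter> space P))"
    unfolding spaces_eq by (rule Q.prob_counts[OF E, symmetric])
  also have "(\<integral>\<^sup>+x. ennreal (w x) \<partial>?C) = ennreal (\<Prod>i\<in>I. exp (1 + m i - 2 * l i) * exp ((l i)\<^sup>2 / m i - 1))"
    unfolding w_def by (intro nn_integral_PiM_unit_poisson_geometric P.I) auto
  also have "(\<Prod>i\<in>I. exp (1 + m i - 2 * l i) * exp ((l i)\<^sup>2 / m i - 1)) = exp (\<Sum>i\<in>I. (m i - l i)\<^sup>2 / m i)"
    unfolding exp_sum[OF P.I(1)]
  proof (rule prod.cong)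
    fix i assume "i \<in> I"
    then have "m i = 0 \<Longrightarrow> l i = 0" using le[of i] measure_nonneg[of L "D i"] by linarith
    then have "(1 + m i - 2 * l i) + ((l i)\<^sup>2 / m i - 1) = (m i - l i)\<^sup>2 / m i"
      by (cases "m i = 0") (auto simp: field_simps power2_eq_square)
    then show "exp (1 + m i - 2 * l i) * exp ((l i)\<^sup>2 / m i - 1) = exp ((m i - l i)\<^sup>2 / m i)"
      by (simp flip: exp_add)
  qed simp
  finally show ?thesis
    using t by (simp flip: ennreal_mult ennreal_plus)
qed

text \<open>For \<open>A = {p \<ge> q}\<close> both probabilities are at most the affinity \<open>\<integral> sqrt (p q)\<close>.\<close>

lemma separating_event:
  "\<exists>A\<in>sets (point_pattern_space S).
     Q.prob A \<le> exp (- (1 / 2) * (\<Sum>i\<in>I. (sqrt (l i) - sqrt (m i))\<^sup>2)) \<and>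
     P.prob (space P - A) \<le> exp (- (1 / 2) * (\<Sum>i\<in>I. (sqrt (l i) - sqrt (m i))\<^sup>2))"
proof -
  let ?C = "Pi\<^sub>M I (\<lambda>_. unit_poisson)"
  \<comment> \<open>The geometric mean of the two densities, again written as a product of terms
    \<open>K * a ^ k\<close>; its integral is the affinity.\<close>
  define \<rho> where "\<rho> x = (\<Prod>i\<in>I. exp (1 - (l i + m i) / 2) * sqrt (l i * m i) ^ natval (x i))" for x
  have \<rho>0: "\<rho> x \<ge> 0" for x by (auto simp: \<rho>_def intro!: prod_nonneg)
  have \<rho>2: "(\<rho> x)\<^sup>2 = P.pdens x * Q.pdens x" for x
    unfolding P.pdens_def Q.pdens_def \<rho>_def prod.distrib[symmetric] prod_power_distrib
  proof (rule prod.cong)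
    fix i
    have "(exp (1 - (l i + m i) / 2))\<^sup>2 = exp (1 - l i) * exp (1 - m i)"
      by (simp add: power2_eq_square flip: exp_add)
    moreover have "(sqrt (l i * m i) ^ natval (x i))\<^sup>2 = l i ^ natval (x i) * m i ^ natval (x i)"
      by (subst power2_eq_square) (simp flip: power_mult_distrib)
    ultimately show "(exp (1 - (l i + m i) / 2) * sqrt (l i * m i) ^ natval (x i))\<^sup>2 =
      poisson_density (l i) (x i) * poisson_density (m i) (x i)"
      by (simp add: poisson_density_def power_mult_distrib)
  qed simp
  have int\<rho>: "(\<integral>\<^sup>+x. ennreal (\<rho> x) \<partial>?C) = ennreal (exp (- (1 / 2) * (\<Sum>i\<in>I. (sqrt (l i) - sqrt (m i))\<^sup>2)))"
  proof -
    have "(\<integral>\<^sup>+x. ennreal (\<rho> x) \<partial>?C) = ennreal (\<Prod>i\<in>I. exp (1 - (l i + m i) / 2) * exp (sqrt (l i * m i) - 1))"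
      unfolding \<rho>_def by (intro nn_integral_PiM_unit_poisson_geometric P.I) auto
    \<comment> \<open>In each cell the exponents add up to
      \<open>sqrt (l i * m i) - (l i + m i) / 2\<close>, which is minus half the squared difference
      of the roots.\<close>
    also have "(\<Prod>i\<in>I. exp (1 - (l i + m i) / 2) * exp (sqrt (l i * m i) - 1))
      = exp (- (1 / 2) * (\<Sum>i\<in>I. (sqrt (l i) - sqrt (m i))\<^sup>2))"
      unfolding sum_distrib_left exp_sum[OF P.I(1)]
      by (intro prod.cong refl) (simp add: power2_diff real_sqrt_mult field_simps flip: exp_add)
    finally show ?thesis .
  qed
  define E where "E = {x \<in> space (Pi\<^sub>M I (\<lambda>_. borel)). Q.pdens x \<le> P.pdens x}"
  have E: "E \<in> sets (Pi\<^sub>M I (\<lambda>_. borel))"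
    unfolding E_def P.pdens_def Q.pdens_def by measurable
  have spC: "space ?C = space (Pi\<^sub>M I (\<lambda>_. borel :: ennreal measure))"
    by (intro sets_eq_imp_space_eq sets_PiM_cong) auto
  let ?A = "counts I D -` E \<inter> space P"
  have "ennreal (Q.prob ?A) = (\<integral>\<^sup>+x. ennreal (Q.pdens x) * indicator E x \<partial>?C)"
    unfolding spaces_eq by (rule Q.prob_counts[OF E])
  also have "\<dots> \<le> (\<integral>\<^sup>+x. ennreal (\<rho> x) \<partial>?C)"
  proof (rule nn_integral_mono)
    fix x
    have "Q.pdens x \<le> \<rho> x" if "x \<in> E"
    proof (rule power2_le_imp_le[OF _ \<rho>0])
      show "(Q.pdens x)\<^sup>2 \<le> (\<rho> x)\<^sup>2"
        unfolding \<rho>2 unfolding power2_eq_square using that by (intro mult_right_mono) (simp_all add: E_def)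
    qed
    then show "ennreal (Q.pdens x) * indicator E x \<le> ennreal (\<rho> x)"
      by (auto split: split_indicator intro: ennreal_leI)
  qed
  finally have 1: "Q.prob ?A \<le> exp (- (1 / 2) * (\<Sum>i\<in>I. (sqrt (l i) - sqrt (m i))\<^sup>2))"
    by (simp add: int\<rho>)
  let ?F = "space (Pi\<^sub>M I (\<lambda>_. borel)) - E"
  have F: "?F \<in> sets (Pi\<^sub>M I (\<lambda>_. borel))" using E by auto
  have "space P - ?A = counts I D -` ?F \<inter> space P"
    using measurable_space[OF P.measurable_counts_P] by auto
  then have "ennreal (P.prob (space P - ?A)) = (\<integral>\<^sup>+x. ennreal (P.pdens x) * indicator ?F x \<partial>?C)"
    using P.prob_counts[OF F] by simp
  also have "\<dots> \<le> (\<integral>\<^sup>+x. ennreal (\<rho> x) \<partial>?C)"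
  proof (rule nn_integral_mono)
    fix x
    have "P.pdens x \<le> \<rho> x" if "x \<in> ?F"
    proof (rule power2_le_imp_le[OF _ \<rho>0])
      show "(P.pdens x)\<^sup>2 \<le> (\<rho> x)\<^sup>2"
        unfolding \<rho>2 unfolding power2_eq_square using that by (intro mult_left_mono) (auto simp: E_def)
    qed
    then show "ennreal (P.pdens x) * indicator ?F x \<le> ennreal (\<rho> x)"
      by (auto split: split_indicator intro: ennreal_leI)
  qed
  finally have 2: "P.prob (space P - ?A) \<le> exp (- (1 / 2) * (\<Sum>i\<in>I. (sqrt (l i) - sqrt (m i))\<^sup>2))"
    by (simp add: int\<rho>)
  have "?A \<in> sets P" using P.measurable_counts_P E by (rule measurable_sets)
  then have "?A \<in> sets (point_pattern_space S)" using P.PP by (simp add: poisson_PP_def)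
  then show ?thesis using 1 2 by blast
qed

end

section \<open>Cylinder events and absolute continuity\<close>

lemma point_patternsD: "\<eta> \<in> point_patterns S \<Longrightarrow> sets \<eta> = sets S"
  by (simp add: point_patterns_def)

lemma measurable_into_point_pattern_space:
  assumes "\<And>x. x \<in> space N \<Longrightarrow> f x \<in> point_patterns S"
    and "\<And>B. B \<in> sets S \<Longrightarrow> (\<lambda>x. emeasure (f x) B) \<in> borel_measurable N"
  shows "f \<in> N \<rightarrow>\<^sub>M point_pattern_space S"
  unfolding point_pattern_space_def
  by (rule measurable_Sup2) (use assms in \<open>auto intro!: measurable_vimage_algebra2\<close>)

text \<open>The cells are the atoms of the family, one for each pattern of membership. Points
  outside all members are discarded, so that every nonempty cell lies in some member and inherits
  its finite mean; the complement of the union could have infinite mean.\<close>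

lemma common_disjoint_refinement:
  assumes F: "finite F" "F \<subseteq> sets S"
  obtains C where "finite C" "C \<subseteq> sets S" "disjoint C" "\<And>A. A \<in> C \<Longrightarrow> A = {} \<or> (\<exists>B\<in>F. A \<subseteq> B)"
    "\<And>B. B \<in> F \<Longrightarrow> B = \<Union>{A \<in> C. A \<subseteq> B}"
proof -
  define cell where "cell G = {y \<in> space S. (\<exists>B\<in>F. y \<in> B) \<and> (\<forall>B\<in>F. y \<in> B \<longleftrightarrow> B \<in> G)}" for G
  have Fs: "y \<in> space S" if "B \<in> F" "y \<in> B" for B y using F sets.sets_into_space that by blast
  show thesis
  proof (rule that[of "cell ` Pow F"])
    show "cell ` Pow F \<subseteq> sets S"
    proof safe
      fix G
      have "{y \<in> space S. y \<in> B} \<in> sets S" if "B \<in> F" for B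
        using that F Fs by (metis (no_types, lifting) Collect_cong Collect_mem_eq subset_iff)
      then have "{y \<in> space S. y \<in> B} \<in> sets S" "{y \<in> space S. y \<in> B \<longleftrightarrow> B \<in> G} \<in> sets S" if "B \<in> F" for B
        using that by (cases "B \<in> G"; simp add: sets.sets_Collect_neg)+
      then show "cell G \<in> sets S"
        unfolding cell_def using F(1)
        by (intro sets.sets_Collect_conj sets.sets_Collect_finite_Ex sets.sets_Collect_finite_All)
    qed
    show "disjoint (cell ` Pow F)"
      unfolding disjoint_def
    proof (intro ballI impI)
      fix a b assume "a \<in> cell ` Pow F" "b \<in> cell ` Pow F" "a \<noteq> b"
      then obtain G H where GH: "a = cell G" "b = cell H" "G \<subseteq> F" "H \<subseteq> F" "G \<noteq> H" by blast
      then obtain B where "B \<in> F" "B \<in> G \<longleftrightarrow> B \<notin> H" by blast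
      then show "a \<inter> b = {}" using GH by (auto simp: cell_def)
    qed
    show "A = {} \<or> (\<exists>B\<in>F. A \<subseteq> B)" if "A \<in> cell ` Pow F" for A
    proof -
      obtain G where G: "A = cell G" "G \<subseteq> F" using \<open>A \<in> cell ` Pow F\<close> by blast
      show ?thesis
      proof (cases "A = {}")
        case False
        then obtain x where "x \<in> A" by blast
        then obtain B where "B \<in> F" "x \<in> B" using G by (auto simp: cell_def)
        then have "B \<in> G" using \<open>x \<in> A\<close> G by (auto simp: cell_def)
        then show ?thesis using G \<open>B \<in> F\<close> by (intro disjI2 bexI[of _ B]) (auto simp: cell_def)
      qed simp
    qed
    show "B = \<Union>{A \<in> cell ` Pow F. A \<subseteq> B}" if B: "B \<in> F" for B
    proof (intro equalityI subsetI)
      fix x assume x: "x \<in> B"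
      let ?G = "{B \<in> F. x \<in> B}"
      have "x \<in> cell ?G" using x B Fs by (auto simp: cell_def)
      moreover have "cell ?G \<subseteq> B" using x B by (auto simp: cell_def)
      ultimately show "x \<in> \<Union>{A \<in> cell ` Pow F. A \<subseteq> B}"
        by (intro UnionI[of "cell ?G"]) auto
    qed auto
  qed (use F in auto)
qed

text \<open>The parameter \<open>R\<close> restricts the sets that may be counted; it is later the
  class of sets of finite mean, for which count densities exist.\<close>

definition cylinder_events :: "'a measure \<Rightarrow> 'a set set \<Rightarrow> 'a measure set set" where
  "cylinder_events S R = {counts F id -` E \<inter> point_patterns S |F E.
     finite F \<and> F \<subseteq> R \<and> E \<in> sets (Pi\<^sub>M F (\<lambda>_. borel))}"

lemma counts_restrict:
  assumes "F \<subseteq> H"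
  shows "counts F id \<eta> = restrict (counts H id \<eta>) F"
  using assms by (auto simp: counts_def fun_eq_iff)

text \<open>Events over \<open>F\<close> and over \<open>H\<close> both pull back to events over
  \<open>F \<union> H\<close>, where their union can be formed.\<close>

lemma algebra_cylinder_events: "algebra (point_patterns S) (cylinder_events S R)"
  unfolding algebra_iff_Un
proof (intro conjI ballI)
  show "cylinder_events S R \<subseteq> Pow (point_patterns S)" by (auto simp: cylinder_events_def)
  show "{} \<in> cylinder_events S R"
    unfolding cylinder_events_def by (intro CollectI exI[of _ "{}"]) auto
  fix a assume "a \<in> cylinder_events S R"
  then obtain F E where a: "a = counts F id -` E \<inter> point_patterns S" "finite F" "F \<subseteq> R"
    "E \<in> sets (Pi\<^sub>M F (\<lambda>_. borel))" by (auto simp: cylinder_events_def)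
  have "counts F id \<eta> \<in> space (Pi\<^sub>M F (\<lambda>_. borel))" for \<eta> :: "'a measure"
    by (auto simp: counts_def space_PiM)
  then have "point_patterns S - a = counts F id -` (space (Pi\<^sub>M F (\<lambda>_. borel)) - E) \<inter> point_patterns S"
    using a by auto
  then show "point_patterns S - a \<in> cylinder_events S R"
    using a unfolding cylinder_events_def by blast
  fix b assume "b \<in> cylinder_events S R"
  then obtain H E' where b: "b = counts H id -` E' \<inter> point_patterns S" "finite H" "H \<subseteq> R"
    "E' \<in> sets (Pi\<^sub>M H (\<lambda>_. borel))" by (auto simp: cylinder_events_def)
  let ?P = "Pi\<^sub>M (F \<union> H) (\<lambda>_. borel :: ennreal measure)"
  let ?E = "((\<lambda>x. restrict x F) -` E \<inter> space ?P) \<union> ((\<lambda>x. restrict x H) -` E' \<inter> space ?P)"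
  have "?E \<in> sets ?P"
    using a b by (intro sets.Un measurable_sets[OF measurable_restrict_subset]) auto
  moreover have "a \<union> b = counts (F \<union> H) id -` ?E \<inter> point_patterns S"
    using counts_restrict[of F "F \<union> H"] counts_restrict[of H "F \<union> H"]
    by (auto simp: a b counts_def space_PiM)
  ultimately show "a \<union> b \<in> cylinder_events S R"
    using a b unfolding cylinder_events_def
    by (intro CollectI exI[of _ "F \<union> H"] exI[of _ ?E] conjI) auto
qed

text \<open>Finite-mean cylinders suffice: by sigma-finiteness the count of any \<open>B\<close> is
  a countable sum of counts of the finite-mean pieces \<open>B \<inter> A i\<close>, hence
  measurable for the generated sigma-algebra.\<close>

lemma sigma_sets_cylinder_events:
  assumes "sigma_finite_measure X" and X: "sets X = sets S"
  shows "sigma_sets (point_patterns S) (cylinder_events S {B \<in> sets S. emeasure X B < \<infinity>})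
    = sets (point_pattern_space S)" (is "sigma_sets ?X ?G = _")
proof
  have "?G \<subseteq> sets (point_pattern_space S)"
  proof
    fix a assume "a \<in> ?G"
    then obtain F E where a: "a = counts F id -` E \<inter> point_patterns S" "F \<subseteq> sets S"
      "E \<in> sets (Pi\<^sub>M F (\<lambda>_. borel))" by (auto simp: cylinder_events_def)
    then show "a \<in> sets (point_pattern_space S)"
      using measurable_sets[OF measurable_counts[of F id S], of E] by (auto simp: space_point_pattern_space)
  qed
  then show "sigma_sets ?X ?G \<subseteq> sets (point_pattern_space S)"
    using sets.sigma_sets_subset[of ?G "point_pattern_space S"] by (simp add: space_point_pattern_space)
next
  let ?N = "sigma ?X ?G"
  have GX: "?G \<subseteq> Pow ?X" by (auto simp: cylinder_events_def)
  have sN: "space ?N = ?X" "sets ?N = sigma_sets ?X ?G" using GX by auto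
  have fin: "(\<lambda>\<eta>. emeasure \<eta> B) \<in> borel_measurable ?N" if B: "B \<in> sets S" "emeasure X B < \<infinity>" for B
  proof (rule measurableI)
    fix T :: "ennreal set" assume T: "T \<in> sets borel"
    let ?E = "(\<lambda>x. x B) -` T \<inter> space (Pi\<^sub>M {B} (\<lambda>_. borel :: ennreal measure))"
    have "?E \<in> sets (Pi\<^sub>M {B} (\<lambda>_. borel))"
      using T by (intro measurable_sets[OF measurable_component_singleton]) auto
    moreover have "(\<lambda>\<eta>. emeasure \<eta> B) -` T \<inter> space ?N = counts {B} id -` ?E \<inter> ?X"
      unfolding sN by (auto simp: counts_def space_PiM)
    ultimately have "(\<lambda>\<eta>. emeasure \<eta> B) -` T \<inter> space ?N \<in> ?G"
      using B unfolding cylinder_events_def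
      by (intro CollectI exI[of _ "{B}"] exI[of _ ?E] conjI) auto
    then show "(\<lambda>\<eta>. emeasure \<eta> B) -` T \<inter> space ?N \<in> sets ?N"
      using sN by auto
  qed simp
  obtain A :: "nat \<Rightarrow> 'a set" where A: "range A \<subseteq> sets X" "(\<Union>i. A i) = space X" "\<And>i. emeasure X (A i) \<noteq> \<infinity>"
    "disjoint_family A"
    using sigma_finite_measure.sigma_finite_disjoint[OF assms(1)] by metis
  have AS: "A i \<in> sets S" for i using A X by auto
  have spX: "space X = space S" using X by (rule sets_eq_imp_space_eq)
  have "(\<lambda>\<eta>. emeasure \<eta> B) \<in> borel_measurable ?N" if B: "B \<in> sets S" for B :: "'a set"
  proof -
    have "emeasure X (B \<inter> A i) < \<infinity>" for i
    proof -
      have "emeasure X (B \<inter> A i) \<le> emeasure X (A i)" using A by (intro emeasure_mono) auto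
      then show ?thesis using A(3)[of i] by (auto simp: less_top top_unique)
    qed
    then have "(\<lambda>\<eta>. \<Sum>i. emeasure \<eta> (B \<inter> A i)) \<in> borel_measurable ?N"
      using B AS by (intro borel_measurable_suminf_order fin) auto
    moreover have "emeasure \<eta> B = (\<Sum>i. emeasure \<eta> (B \<inter> A i))" if "\<eta> \<in> ?X" for \<eta>
    proof -
      have "B \<subseteq> (\<Union>i. A i)" using B sets.sets_into_space A(2) spX by auto
      then have "B = (\<Union>i. B \<inter> A i)" by blast
      moreover have "(\<Sum>i. emeasure \<eta> (B \<inter> A i)) = emeasure \<eta> (\<Union>i. B \<inter> A i)"
        using A(4) B AS point_patternsD[OF that]
        by (intro suminf_emeasure) (auto simp: disjoint_family_on_def)
      ultimately show ?thesis by simp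
    qed
    ultimately show ?thesis
      by (subst measurable_cong[where g = "\<lambda>\<eta>. \<Sum>i. emeasure \<eta> (B \<inter> A i)"]) (simp_all only: sN)
  qed
  \<comment> \<open>Measurability of the identity map is the inclusion of the one sigma-algebra in
    the other.\<close>
  then have "(\<lambda>\<eta>. \<eta>) \<in> ?N \<rightarrow>\<^sub>M point_pattern_space S"
    by (intro measurable_into_point_pattern_space) (simp_all only: sN)
  then have *: "(\<lambda>\<eta>. \<eta>) -` a \<inter> space ?N \<in> sets ?N" if "a \<in> sets (point_pattern_space S)" for a
    using that by (rule measurable_sets)
  show "sets (point_pattern_space S) \<subseteq> sigma_sets ?X ?G"
  proof
    fix a assume a: "a \<in> sets (point_pattern_space S)"
    then have "a \<subseteq> ?X" using sets.sets_into_space by (auto simp flip: space_point_pattern_space)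
    then show "a \<in> sigma_sets ?X ?G" using *[OF a] unfolding sN by (simp add: Int_absorb2)
  qed
qed

section \<open>Absolute continuity from a uniform chi-square bound\<close>

text \<open>Since \<kappa> is the same for all finite families of cells,
  \<open>P.prob a \<le> t * Q.prob a + exp \<kappa> / t\<close> holds with one constant for all
  cylinder events and therefore survives the passage to the sigma-algebra.\<close>

lemma absolutely_continuous_poisson_PP:
  assumes PPL: "poisson_PP S L P" and PPX: "poisson_PP S X Q"
    and le: "\<And>B. B \<in> sets S \<Longrightarrow> emeasure L B \<le> emeasure X B"
    and chi: "\<And>C. finite C \<Longrightarrow> C \<subseteq> {B \<in> sets S. emeasure X B < \<infinity>} \<Longrightarrow> disjoint C \<Longrightarrow>
      (\<Sum>B\<in>C. (measure X B - measure L B)\<^sup>2 / measure X B) \<le> \<kappa>"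
  shows "absolutely_continuous Q P"
proof -
  interpret P: prob_space P using PPL by (simp add: poisson_PP_def)
  interpret Q: prob_space Q using PPX by (simp add: poisson_PP_def)
  let ?R = "{B \<in> sets S. emeasure X B < \<infinity>}"
  let ?G = "cylinder_events S ?R"
  have sX: "sigma_finite_measure X" "sets X = sets S" using PPX by (auto simp: poisson_PP_def)
  note gen = sigma_sets_cylinder_events[OF sX]
  have sets: "sets P = sigma_sets (point_patterns S) ?G" "sets Q = sigma_sets (point_patterns S) ?G"
    using PPL PPX gen by (auto simp: poisson_PP_def)
  have spQ: "space Q = point_patterns S" and spP: "space P = point_patterns S"
    using PPL PPX sets_eq_imp_space_eq space_point_pattern_space by (metis poisson_PP_def)+
  have cyl: "P.prob a \<le> t * Q.prob a + exp \<kappa> / t" if a: "a \<in> ?G" and t: "t > 0" for a t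
  proof -
    obtain F E where aF: "a = counts F id -` E \<inter> point_patterns S" and F: "finite F" "F \<subseteq> ?R"
      and E: "E \<in> sets (Pi\<^sub>M F (\<lambda>_. borel))" using a by (auto simp: cylinder_events_def)
    have FS: "F \<subseteq> sets S" using F by auto
    obtain C where C: "finite C" "C \<subseteq> sets S" "disjoint C"
      "\<And>A. A \<in> C \<Longrightarrow> A = {} \<or> (\<exists>B\<in>F. A \<subseteq> B)" "\<And>B. B \<in> F \<Longrightarrow> B = \<Union>{A \<in> C. A \<subseteq> B}"
      using common_disjoint_refinement[OF F(1) FS] by blast
    have CX: "emeasure X A < \<infinity>" if A: "A \<in> C" for A
    proof (cases "A = {}")
      case False
      then obtain B where B: "B \<in> F" "A \<subseteq> B" using C(4) A by blast
      then have "emeasure X A \<le> emeasure X B" using F sX by (intro emeasure_mono) auto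
      then show ?thesis using B F by (auto intro: le_less_trans)
    qed simp
    then have CR: "C \<subseteq> ?R" using C by auto
    have CL: "emeasure L A < \<infinity>" if A: "A \<in> C" for A
      using le[of A] C CX[OF A] A by (auto intro: le_less_trans)
    have dC: "disjoint_family_on id C" using C(3) by (auto simp: disjoint_def disjoint_family_on_def)
    interpret two_poisson_cells S L P X Q C id
      using PPL PPX C dC CX CL by unfold_locales auto
    \<comment> \<open>Recovers the counts of the possibly overlapping sets in \<open>F\<close> by
      summing over the disjoint cells inside each, so that every cylinder event over
      \<open>F\<close> is an event about independent counts.\<close>
    define \<Phi> where "\<Phi> x = (\<lambda>B\<in>F. \<Sum>A\<in>{A \<in> C. A \<subseteq> B}. x A :: ennreal)" for x
    have \<Phi>: "\<Phi> \<in> Pi\<^sub>M C (\<lambda>_. borel) \<rightarrow>\<^sub>M Pi\<^sub>M F (\<lambda>_. borel)"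
      unfolding \<Phi>_def by (intro measurable_restrict borel_measurable_sum measurable_component_singleton) auto
    have \<Phi>_counts: "\<Phi> (counts C id \<eta>) = counts F id \<eta>" if \<eta>: "\<eta> \<in> point_patterns S" for \<eta>
    proof
      fix B
      have "(\<Sum>A\<in>{A \<in> C. A \<subseteq> B}. emeasure \<eta> A) = emeasure \<eta> B" if "B \<in> F"
      proof -
        have "(\<Sum>A\<in>{A \<in> C. A \<subseteq> B}. emeasure \<eta> A) = emeasure \<eta> (\<Union>A\<in>{A \<in> C. A \<subseteq> B}. A)"
          using C dC point_patternsD[OF \<eta>]
          by (intro sum_emeasure) (auto simp: disjoint_family_on_def)
        then show ?thesis using C(5)[OF that] by simp
      qed
      then show "\<Phi> (counts C id \<eta>) B = counts F id \<eta> B"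
        by (auto simp: \<Phi>_def counts_def)
    qed
    define E' where "E' = \<Phi> -` E \<inter> space (Pi\<^sub>M C (\<lambda>_. borel :: ennreal measure))"
    have E': "E' \<in> sets (Pi\<^sub>M C (\<lambda>_. borel))" unfolding E'_def using \<Phi> E by (rule measurable_sets)
    have "a = counts C id -` E' \<inter> point_patterns S"
      unfolding aF E'_def using \<Phi>_counts by (auto simp: counts_def space_PiM)
    moreover have "measure L (id A) \<le> measure X (id A)" if "A \<in> C" for A
      using le[of A] C CX[OF that] that by (auto simp: measure_def enn2real_mono)
    ultimately have "P.prob a \<le> t * Q.prob a + exp (\<Sum>A\<in>C. (measure X (id A) - measure L (id A))\<^sup>2 / measure X (id A)) / t"
      using prob_le_chi_square[OF _ t E'] by (simp add: spP spQ)
    also have "\<dots> \<le> t * Q.prob a + exp \<kappa> / t"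
      using chi[OF C(1) CR C(3)] t by (auto intro!: divide_right_mono)
    finally show ?thesis .
  qed
  have all: "P.prob a \<le> t * Q.prob a + exp \<kappa> / t" if "a \<in> sets Q" "t > 0" for a t
    using that sets
    by (intro measure_le_affine_extend[OF P.finite_measure_axioms Q.finite_measure_axioms
          algebra_cylinder_events sets cyl]) auto
  show ?thesis
    unfolding absolutely_continuous_def
  proof
    fix a assume a: "a \<in> null_sets Q"
    then have Q0: "Q.prob a = 0" "a \<in> sets Q" by (auto simp: measure_def)
    \<comment> \<open>On a null set of \<open>Q\<close> only the remainder
      \<open>exp \<kappa> / t\<close> is left; the chosen \<open>t\<close> makes it equal to
      \<open>e\<close>.\<close>
    have "P.prob a \<le> 0 + e" if e: "e > 0" for e
      using all[OF Q0(2), of "exp \<kappa> / e"] e by (simp add: Q0)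
    then have "P.prob a \<le> 0" by (rule field_le_epsilon)
    then show "a \<in> null_sets P"
      using Q0 sets by (intro null_setsI) (auto simp: P.emeasure_eq_measure measure_le_0_iff)
  qed
qed

section \<open>Superposition of restrictions\<close>

text \<open>One operation for two levels: on intensities it glues \<open>M\<close> on
  \<open>A\<close> to \<open>N\<close> off \<open>A\<close>, on point patterns it superposes the
  corresponding restrictions.\<close>

definition splice_measure :: "'a set \<Rightarrow> 'a measure \<Rightarrow> 'a measure \<Rightarrow> 'a measure" where
  "splice_measure A M N = measure_add (density M (indicator A)) (density N (indicator (space N - A)))"

lemma sets_splice_measure [simp]: "sets (splice_measure A M N) = sets M"
  by (simp add: splice_measure_def)

lemma emeasure_splice_measure:
  assumes "sets N = sets M" "A \<in> sets M" "B \<in> sets M"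
  shows "emeasure (splice_measure A M N) B = emeasure M (B \<inter> A) + emeasure N (B - A)"
proof -
  have "B \<subseteq> space N" using assms sets.sets_into_space by (metis sets_eq_imp_space_eq)
  then have "(space N - A) \<inter> B = B - A" by blast
  moreover have "space N - A \<in> sets N" using assms by auto
  ultimately show ?thesis
    using assms by (simp add: splice_measure_def emeasure_measure_add emeasure_restricted Int_commute)
qed

text \<open>The two decompositions into finite integer-valued summands are spliced index by index,
  and each spliced summand is again finite and integer-valued.\<close>

lemma splice_measure_in_point_patterns:
  assumes "\<eta> \<in> point_patterns S" "\<theta> \<in> point_patterns S" and A: "A \<in> sets S"
  shows "splice_measure A \<eta> \<theta> \<in> point_patterns S"
proof -
  obtain m where m: "\<And>k. sets (m k) = sets S" "\<And>k :: nat. finite_measure (m k)"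
    "\<And>k B. B \<in> sets S \<Longrightarrow> emeasure (m k) B \<in> \<nat>" "\<And>B. B \<in> sets S \<Longrightarrow> emeasure \<eta> B = (\<Sum>k. emeasure (m k) B)"
    using assms(1) unfolding point_patterns_def by blast
  obtain n where n: "\<And>k. sets (n k) = sets S" "\<And>k :: nat. finite_measure (n k)"
    "\<And>k B. B \<in> sets S \<Longrightarrow> emeasure (n k) B \<in> \<nat>" "\<And>B. B \<in> sets S \<Longrightarrow> emeasure \<theta> B = (\<Sum>k. emeasure (n k) B)"
    using assms(2) unfolding point_patterns_def by blast
  note sets = point_patternsD[OF assms(1)] point_patternsD[OF assms(2)]
  have sub: "B \<inter> A \<in> sets S" "B - A \<in> sets S" if "B \<in> sets S" for B using that A by auto
  have em: "emeasure (splice_measure A (m k) (n k)) B = emeasure (m k) (B \<inter> A) + emeasure (n k) (B - A)"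
    if "B \<in> sets S" for k B
    using that A m(1) n(1) by (intro emeasure_splice_measure) auto
  show ?thesis
    unfolding point_patterns_def
  proof (intro CollectI conjI exI[of _ "\<lambda>k. splice_measure A (m k) (n k)"] allI ballI)
    show "finite_measure (splice_measure A (m k) (n k))" for k
    proof
      have sp: "space (splice_measure A (m k) (n k)) = space S" by (intro sets_eq_imp_space_eq) (simp add: m)
      show "emeasure (splice_measure A (m k) (n k)) (space (splice_measure A (m k) (n k))) \<noteq> \<infinity>"
        unfolding sp em[OF sets.top]
        using finite_measure.emeasure_finite[OF m(2)] finite_measure.emeasure_finite[OF n(2)]
        by simp
    qed
    show "emeasure (splice_measure A (m k) (n k)) B \<in> \<nat>" if "B \<in> sets S" for k B
      unfolding em[OF that] using m(3) n(3) sub[OF that] by (intro Nats_add) auto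
    show "emeasure (splice_measure A \<eta> \<theta>) B = (\<Sum>k. emeasure (splice_measure A (m k) (n k)) B)" if "B \<in> sets S" for B
    proof -
      have "emeasure (splice_measure A \<eta> \<theta>) B = emeasure \<eta> (B \<inter> A) + emeasure \<theta> (B - A)"
        using sets that A by (intro emeasure_splice_measure) auto
      then show ?thesis
        using m(4) n(4) sub[OF that] by (simp add: em[OF that] suminf_add[symmetric])
    qed
  qed (simp_all add: sets m)
qed

lemma sigma_finite_splice_measure:
  assumes "sigma_finite_measure M" "sigma_finite_measure N" "sets N = sets M" "A \<in> sets M"
  shows "sigma_finite_measure (splice_measure A M N)"
proof -
  have "sigma_finite_measure (density M (\<lambda>x. indicator A x))"
    using assms by (subst sigma_finite_measure.sigma_finite_iff_density_finite) (auto simp: indicator_def)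
  moreover have "sigma_finite_measure (density N (\<lambda>x. indicator (space N - A) x))"
    using assms by (subst sigma_finite_measure.sigma_finite_iff_density_finite) (auto simp: indicator_def)
  ultimately show ?thesis
    unfolding splice_measure_def using assms by (intro sigma_finite_measure_add) auto
qed

text \<open>For disjoint \<open>B i\<close> the sets \<open>B i \<inter> A\<close> are disjoint, as
  are the sets \<open>B i - A\<close>, so each process contributes independent counts, and the
  product measure makes the processes independent of each other. Each count is a sum of two
  independent Poisson variables. Infinite means are allowed here, so the argument uses laws on
  \<open>ennreal\<close> and not densities.\<close>

lemma poisson_PP_splice_measure:
  assumes PPL: "poisson_PP S L P" and PPM: "poisson_PP S M Q" and A: "A \<in> sets S"
  shows "poisson_PP S (splice_measure A L M)
    (distr (P \<Otimes>\<^sub>M Q) (point_pattern_space S) (\<lambda>(\<eta>, \<theta>). splice_measure A \<eta> \<theta>))"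
proof -
  interpret P: prob_space P using PPL by (simp add: poisson_PP_def)
  interpret Q: prob_space Q using PPM by (simp add: poisson_PP_def)
  interpret PQ: pair_prob_space P Q ..
  have sL: "sets L = sets S" and sM: "sets M = sets S"
    and sP: "sets P = sets (point_pattern_space S)" and sQ: "sets Q = sets (point_pattern_space S)"
    using PPL PPM by (auto simp: poisson_PP_def)
  have spP: "space P = point_patterns S" and spQ: "space Q = point_patterns S"
    using sP sQ sets_eq_imp_space_eq space_point_pattern_space by metis+
  have U[measurable]: "(\<lambda>\<eta>. emeasure \<eta> B) \<in> borel_measurable P" "(\<lambda>\<eta>. emeasure \<eta> B) \<in> borel_measurable Q"
    if "B \<in> sets S" for B
    using measurable_emeasure_point_pattern_space[OF that] sP sQ by (simp_all cong: measurable_cong_sets)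
  have em: "emeasure (splice_measure A \<eta> \<theta>) B = emeasure \<eta> (B \<inter> A) + emeasure \<theta> (B - A)"
    if "\<eta> \<in> space P" "\<theta> \<in> space Q" "B \<in> sets S" for \<eta> \<theta> B
    using that point_patternsD A by (intro emeasure_splice_measure) (auto simp: spP spQ)
  define T :: "'a measure \<times> 'a measure \<Rightarrow> 'a measure" where "T = (\<lambda>(\<eta>, \<theta>). splice_measure A \<eta> \<theta>)"
  have T: "T \<in> P \<Otimes>\<^sub>M Q \<rightarrow>\<^sub>M point_pattern_space S"
  proof (rule measurable_into_point_pattern_space)
    show "T x \<in> point_patterns S" if "x \<in> space (P \<Otimes>\<^sub>M Q)" for x
      using that splice_measure_in_point_patterns[OF _ _ A] by (auto simp: T_def space_pair_measure spP spQ)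
    show "(\<lambda>x. emeasure (T x) B) \<in> borel_measurable (P \<Otimes>\<^sub>M Q)" if B: "B \<in> sets S" for B
    proof -
      have BA: "B \<inter> A \<in> sets S" "B - A \<in> sets S" using A B by auto
      have "(\<lambda>x. emeasure (fst x) (B \<inter> A) + emeasure (snd x) (B - A)) \<in> borel_measurable (P \<Otimes>\<^sub>M Q)"
        using BA by measurable
      then show ?thesis
        by (rule measurable_cong[THEN iffD1, rotated]) (auto simp: T_def space_pair_measure em B)
    qed
  qed
  define R where "R = distr (P \<Otimes>\<^sub>M Q) (point_pattern_space S) T"
  interpret R: prob_space R unfolding R_def using T by (rule PQ.prob_space_distr)
  have sR: "sets R = sets (point_pattern_space S)" by (simp add: R_def)
  have UR: "(\<lambda>\<eta>. emeasure \<eta> B) \<in> borel_measurable R" if "B \<in> sets S" for B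
    using measurable_emeasure_point_pattern_space[OF that] sR by (simp cong: measurable_cong_sets)
  \<comment> \<open>Serves twice: a single index gives the law of one count, and the comparison with
    several indices gives independence.\<close>
  have prod_formula: "(\<integral>\<^sup>+\<eta>. (\<Prod>i\<in>I. indicator (E i) (emeasure \<eta> (B i))) \<partial>R) =
      (\<Prod>i\<in>I. \<integral>\<^sup>+u. \<integral>\<^sup>+v. indicator (E i) (u + v) \<partial>distr Q borel (\<lambda>\<eta>. emeasure \<eta> (B i - A)) \<partial>distr P borel (\<lambda>\<eta>. emeasure \<eta> (B i \<inter> A)))"
    if I: "finite I" "\<And>i. i \<in> I \<Longrightarrow> B i \<in> sets S" "disjoint_family_on B I"
      and E: "\<And>i. i \<in> I \<Longrightarrow> E i \<in> sets borel" for I :: "nat set" and B and E :: "nat \<Rightarrow> ennreal set"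
  proof -
    have BA: "B i \<inter> A \<in> sets S" "B i - A \<in> sets S" if "i \<in> I" for i using I(2)[OF that] A by auto
    have iP: "P.indep_vars (\<lambda>_. borel) (\<lambda>i \<eta>. emeasure \<eta> (B i \<inter> A)) I"
      using I BA by (intro poisson_PP_indep_vars[OF PPL]) (auto simp: disjoint_family_on_def)
    have iQ: "Q.indep_vars (\<lambda>_. borel) (\<lambda>i \<eta>. emeasure \<eta> (B i - A)) I"
      using I BA by (intro poisson_PP_indep_vars[OF PPM]) (auto simp: disjoint_family_on_def)
    define g where "g i u = (\<integral>\<^sup>+v. indicator (E i) (u + v) \<partial>distr Q borel (\<lambda>\<eta>. emeasure \<eta> (B i - A)))" for i u
    have g: "g i \<in> borel_measurable borel" if i: "i \<in> I" for i
    proof -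
      interpret D: prob_space "distr Q borel (\<lambda>\<eta>. emeasure \<eta> (B i - A))"
        using BA[OF i] U by (intro Q.prob_space_distr) auto
      show ?thesis unfolding g_def using E[OF i] by measurable
    qed
    have "(\<lambda>\<eta>. \<Prod>i\<in>I. indicator (E i) (emeasure \<eta> (B i)) :: ennreal) \<in> borel_measurable (point_pattern_space S)"
      using I E measurable_emeasure_point_pattern_space
      by (intro borel_measurable_prod_ennreal measurable_compose[OF measurable_emeasure_point_pattern_space]) auto
    then have "(\<integral>\<^sup>+\<eta>. (\<Prod>i\<in>I. indicator (E i) (emeasure \<eta> (B i))) \<partial>R) =
        (\<integral>\<^sup>+x. (\<Prod>i\<in>I. indicator (E i) (emeasure (T x) (B i))) \<partial>(P \<Otimes>\<^sub>M Q))"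
      unfolding R_def using T by (subst nn_integral_distr) auto
    also have "\<dots> = (\<integral>\<^sup>+x. (\<Prod>i\<in>I. indicator (E i) (emeasure (fst x) (B i \<inter> A) + emeasure (snd x) (B i - A))) \<partial>(P \<Otimes>\<^sub>M Q))"
      using I by (intro nn_integral_cong prod.cong) (auto simp: T_def space_pair_measure em)
    \<comment> \<open>Fubini. For fixed \<eta> the inner integral factorises by independence under
      \<open>Q\<close>; the factors \<open>g i\<close> depend only on the counts of \<eta> and
      factorise under \<open>P\<close>.\<close>
    also have "\<dots> = (\<integral>\<^sup>+\<eta>. \<integral>\<^sup>+\<theta>. (\<Prod>i\<in>I. indicator (E i) (emeasure \<eta> (B i \<inter> A) + emeasure \<theta> (B i - A))) \<partial>Q \<partial>P)"
    proof (subst Q.nn_integral_fst[symmetric])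
      show "(\<lambda>x. \<Prod>i\<in>I. indicator (E i) (emeasure (fst x) (B i \<inter> A) + emeasure (snd x) (B i - A)) :: ennreal)
        \<in> borel_measurable (P \<Otimes>\<^sub>M Q)"
        using BA E
        by (intro borel_measurable_prod_ennreal measurable_compose[OF _ borel_measurable_indicator[OF E]]
            borel_measurable_add measurable_compose[OF measurable_fst U(1)]
            measurable_compose[OF measurable_snd U(2)])
    qed simp
    also have "\<dots> = (\<integral>\<^sup>+\<eta>. (\<Prod>i\<in>I. g i (emeasure \<eta> (B i \<inter> A))) \<partial>P)"
    proof (rule nn_integral_cong)
      fix \<eta>
      have "(\<integral>\<^sup>+\<theta>. (\<Prod>i\<in>I. indicator (E i) (emeasure \<eta> (B i \<inter> A) + emeasure \<theta> (B i - A))) \<partial>Q)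
        = (\<Prod>i\<in>I. \<integral>\<^sup>+\<theta>. indicator (E i) (emeasure \<eta> (B i \<inter> A) + emeasure \<theta> (B i - A)) \<partial>Q)"
        using E by (intro Q.indep_vars_nn_integral I Q.indep_vars_compose2[OF iQ]) auto
      also have "\<dots> = (\<Prod>i\<in>I. g i (emeasure \<eta> (B i \<inter> A)))"
        unfolding g_def using BA E by (intro prod.cong refl) (subst nn_integral_distr, auto)
      finally show "(\<integral>\<^sup>+\<theta>. (\<Prod>i\<in>I. indicator (E i) (emeasure \<eta> (B i \<inter> A) + emeasure \<theta> (B i - A))) \<partial>Q)
        = (\<Prod>i\<in>I. g i (emeasure \<eta> (B i \<inter> A)))" .
    qed
    also have "\<dots> = (\<Prod>i\<in>I. \<integral>\<^sup>+\<eta>. g i (emeasure \<eta> (B i \<inter> A)) \<partial>P)"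
      using g by (intro P.indep_vars_nn_integral I P.indep_vars_compose2[OF iP]) auto
    also have "\<dots> = (\<Prod>i\<in>I. \<integral>\<^sup>+u. g i u \<partial>distr P borel (\<lambda>\<eta>. emeasure \<eta> (B i \<inter> A)))"
      using BA g by (intro prod.cong refl) (subst nn_integral_distr, auto)
    finally show ?thesis by (simp add: g_def)
  qed
  have dist: "distr R borel (\<lambda>\<eta>. emeasure \<eta> B) = poisson_distribution (emeasure (splice_measure A L M) B)"
    if B: "B \<in> sets S" for B
  proof (rule measure_eqI)
    fix E assume "E \<in> sets (distr R borel (\<lambda>\<eta>. emeasure \<eta> B))"
    then have E: "E \<in> sets borel" by simp
    have BA: "B \<inter> A \<in> sets S" "B - A \<in> sets S" using B A by auto
    have "emeasure (distr R borel (\<lambda>\<eta>. emeasure \<eta> B)) E = (\<integral>\<^sup>+\<eta>. indicator E (emeasure \<eta> B) \<partial>R)"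
      using E UR[OF B] by (intro emeasure_distr_nn_integral)
    also have "\<dots> = (\<integral>\<^sup>+u. \<integral>\<^sup>+v. indicator E (u + v) \<partial>distr Q borel (\<lambda>\<eta>. emeasure \<eta> (B - A)) \<partial>distr P borel (\<lambda>\<eta>. emeasure \<eta> (B \<inter> A)))"
      using prod_formula[of "{0}" "\<lambda>_. B" "\<lambda>_. E"] B E by (simp add: disjoint_family_on_def)
    also have "\<dots> = emeasure (poisson_distribution (emeasure L (B \<inter> A) + emeasure M (B - A))) E"
      using PPL PPM BA poisson_distribution_add[OF E] by (simp add: poisson_PP_def)
    also have "emeasure L (B \<inter> A) + emeasure M (B - A) = emeasure (splice_measure A L M) B"
      using B A sL sM by (subst emeasure_splice_measure) auto
    finally show "emeasure (distr R borel (\<lambda>\<eta>. emeasure \<eta> B)) E =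
      emeasure (poisson_distribution (emeasure (splice_measure A L M) B)) E" .
  qed simp
  have indep: "R.indep_vars (\<lambda>_. borel) (\<lambda>i \<eta>. emeasure \<eta> (B i)) I"
    if I: "finite I" "I \<noteq> {}" "\<And>i. i \<in> I \<Longrightarrow> B i \<in> sets S" "disjoint_family_on B I"
    for I :: "nat set" and B
  proof (subst R.indep_vars_iff_distr_eq_PiM')
    let ?N = "\<lambda>i. if i \<in> I then distr R borel (\<lambda>\<eta>. emeasure \<eta> (B i)) else return borel 0"
    have N: "prob_space (?N i)" for i
      using UR I by (auto intro!: R.prob_space_distr prob_space_return)
    interpret N: product_prob_space ?N by (rule product_prob_spaceI) (rule N)
    have "distr R (Pi\<^sub>M I (\<lambda>_. borel)) (\<lambda>\<eta>. \<lambda>i\<in>I. emeasure \<eta> (B i)) = Pi\<^sub>M I ?N"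
    proof (rule N.PiM_eqI)
      show "sets (distr R (Pi\<^sub>M I (\<lambda>_. borel)) (\<lambda>\<eta>. \<lambda>i\<in>I. emeasure \<eta> (B i))) = sets (Pi\<^sub>M I ?N)"
        by (simp cong: sets_PiM_cong)
      fix E assume "\<And>i. i \<in> I \<Longrightarrow> E i \<in> sets (?N i)"
      then have E: "E i \<in> sets borel" if "i \<in> I" for i using that by (metis sets_distr)
      have m: "(\<lambda>\<eta>. \<lambda>i\<in>I. emeasure \<eta> (B i)) \<in> R \<rightarrow>\<^sub>M Pi\<^sub>M I (\<lambda>_. borel)"
        using UR I by (intro measurable_restrict) auto
      have PE: "Pi\<^sub>E I E \<in> sets (Pi\<^sub>M I (\<lambda>_. borel))" using E I by (intro sets_PiM_I_finite) auto
      have "emeasure (distr R (Pi\<^sub>M I (\<lambda>_. borel)) (\<lambda>\<eta>. \<lambda>i\<in>I. emeasure \<eta> (B i))) (Pi\<^sub>E I E)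
        = (\<integral>\<^sup>+\<eta>. indicator (Pi\<^sub>E I E) (\<lambda>i\<in>I. emeasure \<eta> (B i)) \<partial>R)"
        using PE m by (intro emeasure_distr_nn_integral)
      also have "\<dots> = (\<integral>\<^sup>+\<eta>. (\<Prod>i\<in>I. indicator (E i) (emeasure \<eta> (B i))) \<partial>R)"
        using I by (intro nn_integral_cong) (simp add: prod_indicator_PiE)
      also have "\<dots> = (\<Prod>i\<in>I. \<integral>\<^sup>+\<eta>. indicator (E i) (emeasure \<eta> (B i)) \<partial>R)"
      proof -
        have "(\<integral>\<^sup>+\<eta>. indicator (E i) (emeasure \<eta> (B i)) \<partial>R) = (\<integral>\<^sup>+u. \<integral>\<^sup>+v. indicator (E i) (u + v)
            \<partial>distr Q borel (\<lambda>\<eta>. emeasure \<eta> (B i - A)) \<partial>distr P borel (\<lambda>\<eta>. emeasure \<eta> (B i \<inter> A)))"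
          if "i \<in> I" for i
          using prod_formula[of "{i}" B E] I E that by (simp add: disjoint_family_on_def)
        then show ?thesis using prod_formula[of I B E] I E by simp
      qed
      also have "\<dots> = (\<Prod>i\<in>I. emeasure (?N i) (E i))"
        using UR I E by (intro prod.cong) (simp_all add: emeasure_distr_nn_integral)
      finally show "emeasure (distr R (Pi\<^sub>M I (\<lambda>_. borel)) (\<lambda>\<eta>. \<lambda>i\<in>I. emeasure \<eta> (B i))) (Pi\<^sub>E I E)
        = (\<Prod>i\<in>I. emeasure (?N i) (E i))" .
    qed (rule I)
    also have "Pi\<^sub>M I ?N = Pi\<^sub>M I (\<lambda>i. distr R borel (\<lambda>\<eta>. emeasure \<eta> (B i)))"
      by (rule PiM_cong) auto
    finally show "distr R (Pi\<^sub>M I (\<lambda>_. borel)) (\<lambda>\<eta>. \<lambda>i\<in>I. emeasure \<eta> (B i)) =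
      Pi\<^sub>M I (\<lambda>i. distr R borel (\<lambda>\<eta>. emeasure \<eta> (B i)))" .
  qed (use UR I in auto)
  have "sigma_finite_measure (splice_measure A L M)"
    using PPL PPM A by (intro sigma_finite_splice_measure) (auto simp: poisson_PP_def)
  then have "poisson_PP S (splice_measure A L M) R"
    unfolding poisson_PP_def
    using sL sR R.prob_space_axioms indep dist by (auto simp: Suc_le_eq)
  then show ?thesis by (simp add: R_def T_def)
qed

section \<open>Hellinger integrals\<close>

lemma is_density_emeasure:
  assumes "is_density \<nu> L f" "B \<in> sets \<nu>"
  shows "emeasure L B = (\<integral>\<^sup>+x\<in>B. ennreal (f x) \<partial>\<nu>)"
  using assms by (auto simp: is_density_def emeasure_density)

lemma is_density_sets: "is_density \<nu> L f \<Longrightarrow> sets L = sets \<nu>"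
  by (auto simp: is_density_def)

text \<open>On \<open>D\<close> the relative gap of the roots lies between \<open>d / 2\<close> and
  \<open>d\<close>. The lower bound passes to the masses, so their squared root gap is at least
  \<open>d\<^sup>2 / 4\<close> times the mass of \<open>X\<close>; the upper bound limits the
  integral to \<open>d\<^sup>2\<close> times that mass. The quotient is the factor 4.\<close>

lemma hellinger_cell_bound:
  assumes f: "is_density \<nu> L f" and h: "is_density \<nu> X h" and D: "D \<in> sets \<nu>"
    and fin: "emeasure L D < \<infinity>" "emeasure X D < \<infinity>" and d: "0 < d" "d \<le> 2"
    and 1: "\<And>x. x \<in> D \<Longrightarrow> sqrt (f x) \<le> (1 - d / 2) * sqrt (h x)"
    and 2: "\<And>x. x \<in> D \<Longrightarrow> sqrt (h x) - sqrt (f x) \<le> d * sqrt (h x)"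
  shows "(\<integral>\<^sup>+x\<in>D. ennreal ((sqrt (f x) - sqrt (h x))\<^sup>2) \<partial>\<nu>) \<le> ennreal (4 * (sqrt (measure L D) - sqrt (measure X D))\<^sup>2)"
proof -
  have [measurable]: "f \<in> borel_measurable \<nu>" "h \<in> borel_measurable \<nu>" "D \<in> sets \<nu>"
    and nn: "\<And>x. x \<in> space \<nu> \<Longrightarrow> 0 \<le> f x" "\<And>x. x \<in> space \<nu> \<Longrightarrow> 0 \<le> h x"
    using f h D by (auto simp: is_density_def)
  have Dsp: "x \<in> space \<nu>" if "x \<in> D" for x using that D sets.sets_into_space by blast
  let ?l = "measure L D" and ?m = "measure X D"
  have L: "emeasure L D = ennreal ?l" and X: "emeasure X D = ennreal ?m"
    using fin by (auto simp: emeasure_eq_ennreal_measure)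
  have scale: "(\<integral>\<^sup>+x\<in>D. ennreal (c * h x) \<partial>\<nu>) = ennreal (c * ?m)" if "c \<ge> 0" for c
  proof -
    have "(\<integral>\<^sup>+x\<in>D. ennreal (c * h x) \<partial>\<nu>) = (\<integral>\<^sup>+x. ennreal c * (ennreal (h x) * indicator D x) \<partial>\<nu>)"
      using that Dsp nn by (intro nn_integral_cong) (auto simp: ennreal_mult split: split_indicator)
    also have "\<dots> = ennreal c * emeasure X D"
      by (subst nn_integral_cmult) (auto simp: is_density_emeasure[OF h D])
    finally show ?thesis using that by (simp add: X ennreal_mult)
  qed
  have "ennreal ?l = (\<integral>\<^sup>+x\<in>D. ennreal (f x) \<partial>\<nu>)"
    unfolding L[symmetric] by (rule is_density_emeasure[OF f D])
  also have "\<dots> \<le> (\<integral>\<^sup>+x\<in>D. ennreal ((1 - d / 2)\<^sup>2 * h x) \<partial>\<nu>)"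
  proof (rule nn_integral_mono)
    fix x
    have "f x \<le> (1 - d / 2)\<^sup>2 * h x" if "x \<in> D"
    proof -
      have "(sqrt (f x))\<^sup>2 \<le> ((1 - d / 2) * sqrt (h x))\<^sup>2"
        using 1[OF that] nn Dsp[OF that] by (intro power_mono) auto
      then show ?thesis using nn Dsp[OF that] by (simp add: power_mult_distrib)
    qed
    then show "ennreal (f x) * indicator D x \<le> ennreal ((1 - d / 2)\<^sup>2 * h x) * indicator D x"
      by (auto split: split_indicator intro: ennreal_leI)
  qed
  also have "\<dots> = ennreal ((1 - d / 2)\<^sup>2 * ?m)" by (rule scale) simp
  finally have "?l \<le> (1 - d / 2)\<^sup>2 * ?m" by simp
  then have "sqrt ?l \<le> sqrt ((1 - d / 2)\<^sup>2 * ?m)" by (rule real_sqrt_le_mono)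
  also have "\<dots> = (1 - d / 2) * sqrt ?m" using d by (simp add: real_sqrt_mult)
  finally have "d / 2 * sqrt ?m \<le> sqrt ?m - sqrt ?l" by (simp add: algebra_simps)
  then have "(d / 2 * sqrt ?m)\<^sup>2 \<le> (sqrt ?m - sqrt ?l)\<^sup>2" using d by (intro power_mono) auto
  then have *: "d\<^sup>2 * ?m \<le> 4 * (sqrt ?l - sqrt ?m)\<^sup>2"
    by (simp add: power_mult_distrib power_divide power2_commute)
  have "(\<integral>\<^sup>+x\<in>D. ennreal ((sqrt (f x) - sqrt (h x))\<^sup>2) \<partial>\<nu>) \<le> (\<integral>\<^sup>+x\<in>D. ennreal (d\<^sup>2 * h x) \<partial>\<nu>)"
  proof (rule nn_integral_mono)
    fix x
    have "(sqrt (f x) - sqrt (h x))\<^sup>2 \<le> d\<^sup>2 * h x" if x: "x \<in> D"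
    proof -
      have "(1 - d / 2) * sqrt (h x) \<le> sqrt (h x)"
        using d nn(2)[OF Dsp[OF x]] by (simp add: mult_left_le_one_le algebra_simps)
      with 1[OF x] have "sqrt (f x) \<le> sqrt (h x)" by (rule order_trans)
      then have "(sqrt (h x) - sqrt (f x))\<^sup>2 \<le> (d * sqrt (h x))\<^sup>2"
        using 2[OF x] by (intro power_mono) auto
      then show ?thesis using nn Dsp[OF x] by (simp add: power_mult_distrib power2_commute)
    qed
    then show "ennreal ((sqrt (f x) - sqrt (h x))\<^sup>2) * indicator D x \<le> ennreal (d\<^sup>2 * h x) * indicator D x"
      by (auto split: split_indicator intro: ennreal_leI)
  qed
  also have "\<dots> = ennreal (d\<^sup>2 * ?m)" by (rule scale) simp
  also have "\<dots> \<le> ennreal (4 * (sqrt ?l - sqrt ?m)\<^sup>2)" using * by (rule ennreal_leI)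
  finally show ?thesis .
qed

text \<open>Countably many disjoint cells of finite mean cover \<open>f \<noteq> h\<close>, off
  which the integrand vanishes. If all partial sums stayed below \<open>K\<close>, the bound on each
  cell would limit the integral to \<open>4 * K\<close>.\<close>

lemma finite_cells_of_infinite_hellinger:
  fixes K :: real
  assumes f: "is_density \<nu> L f" and h: "is_density \<nu> X h"
    and sf: "sigma_finite_measure L" "sigma_finite_measure X"
    and inf: "(\<integral>\<^sup>+x. ennreal ((sqrt (f x) - sqrt (h x))\<^sup>2) \<partial>\<nu>) = \<infinity>"
  shows "\<exists>(N :: nat) (D :: nat \<Rightarrow> 'a set). disjoint_family D \<and>
    (\<forall>i. D i \<in> sets \<nu> \<and> emeasure L (D i) < \<infinity> \<and> emeasure X (D i) < \<infinity>) \<and>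
    K \<le> (\<Sum>i<N. (sqrt (measure L (D i)) - sqrt (measure X (D i)))\<^sup>2)"
proof -
  have [measurable]: "f \<in> borel_measurable \<nu>" "h \<in> borel_measurable \<nu>"
    and nn: "\<And>x. x \<in> space \<nu> \<Longrightarrow> 0 \<le> f x" "\<And>x. x \<in> space \<nu> \<Longrightarrow> 0 \<le> h x"
    using f h by (auto simp: is_density_def)
  have sets: "sets L = sets \<nu>" "sets X = sets \<nu>" using f h is_density_sets by auto
  obtain A :: "nat \<Rightarrow> 'a set" where A: "range A \<subseteq> sets L" "(\<Union>i. A i) = space L" "\<And>i. emeasure L (A i) \<noteq> \<infinity>"
    using sigma_finite_measure.sigma_finite[OF sf(1)] by metis
  obtain B :: "nat \<Rightarrow> 'a set" where B: "range B \<subseteq> sets X" "(\<Union>i. B i) = space X" "\<And>i. emeasure X (B i) \<noteq> \<infinity>"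
    using sigma_finite_measure.sigma_finite[OF sf(2)] by metis
  have AB[measurable]: "A i \<in> sets \<nu>" "B i \<in> sets \<nu>" for i using A B sets by auto
  \<comment> \<open>On a cell where \<open>close d (sqrt f) (sqrt h)\<close> holds, the relative gap of the square roots lies
    between \<open>d / 2\<close> and \<open>d\<close>; countably many rational \<open>d\<close> suffice.\<close>
  define close where "close d u v \<longleftrightarrow> u < v \<and> u \<le> (1 - d / 2) * v \<and> v - u \<le> d * v" for d u v :: real
  have close_ex: "\<exists>q. close (real_of_rat q) u v" if "0 \<le> u" "u < v" for u v
  proof -
    have t: "0 < (v - u) / v" using that by simp
    then have "(v - u) / v < 2 * ((v - u) / v)" by linarith
    then obtain q where q: "(v - u) / v < of_rat q" "of_rat q < 2 * ((v - u) / v)"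
      using of_rat_dense by blast
    have "v > 0" using that by simp
    then have "v - u < of_rat q * v" "of_rat q * v < 2 * (v - u)"
      using q by (auto simp: field_simps)
    then show ?thesis using that by (intro exI[of _ q]) (auto simp: close_def algebra_simps)
  qed
  \<comment> \<open>The rational \<open>q\<close> fixes the relative gap, \<open>s\<close> says
    which of the densities is the larger, and \<open>i\<close>, \<open>j\<close> confine the cell to
    sets of finite mass under \<open>L\<close> and \<open>X\<close>.\<close>
  define cell where "cell = (\<lambda>(q, s, i, j).
    {x \<in> space \<nu>. x \<in> A i \<and> x \<in> B j \<and>
      (if s then close (of_rat q) (sqrt (f x)) (sqrt (h x)) else close (of_rat q) (sqrt (h x)) (sqrt (f x)))})"
  define C where "C n = cell (from_nat n :: rat \<times> bool \<times> nat \<times> nat)" for n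
  have cell_sets: "cell z \<in> sets \<nu>" for z
  proof -
    obtain q s i j where z: "z = (q, s, i, j)" by (cases z) auto
    show ?thesis unfolding z cell_def close_def by (cases s) simp_all
  qed
  \<comment> \<open>Making the cells disjoint only shrinks them, and the conditions on a cell are
    pointwise, so they persist.\<close>
  define D where "D = disjointed C"
  have Dm[measurable]: "D n \<in> sets \<nu>" for n
  proof -
    have "range C \<subseteq> sets \<nu>" using cell_sets unfolding C_def by blast
    then show ?thesis unfolding D_def using sets.range_disjointed_sets by blast
  qed
  have disj: "disjoint_family D" unfolding D_def by (rule disjoint_family_disjointed)
  have DC: "D n \<subseteq> C n" for n unfolding D_def by (rule disjointed_subset)
  have UD: "(\<Union>n. D n) = {x \<in> space \<nu>. f x \<noteq> h x}"
  proof -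
    have "(\<Union>n. D n) = (\<Union>n. C n)" unfolding D_def by (rule UN_disjointed_eq)
    also have "\<dots> = (\<Union>z. cell z)"
    proof (intro equalityI subsetI)
      fix x assume "x \<in> (\<Union>z. cell z)"
      then obtain z where "x \<in> cell z" by blast
      then have "x \<in> C (to_nat z)" by (simp add: C_def)
      then show "x \<in> (\<Union>n. C n)" by blast
    qed (unfold C_def, blast)
    also have "\<dots> = {x \<in> space \<nu>. f x \<noteq> h x}"
    proof (intro equalityI subsetI)
      fix x assume "x \<in> {x \<in> space \<nu>. f x \<noteq> h x}"
      then have x: "x \<in> space \<nu>" "f x \<noteq> h x" by auto
      have "space L = space \<nu>" "space X = space \<nu>" using sets sets_eq_imp_space_eq by blast+
      then obtain i j where ij: "x \<in> A i" "x \<in> B j" using A(2) B(2) x by blast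
      show "x \<in> (\<Union>z. cell z)"
      proof (cases "f x < h x")
        case True
        then obtain q where "close (of_rat q) (sqrt (f x)) (sqrt (h x))"
          using close_ex[of "sqrt (f x)" "sqrt (h x)"] nn x by auto
        then have "x \<in> cell (q, True, i, j)" using x ij by (simp add: cell_def)
        then show ?thesis by blast
      next
        case False
        then obtain q where "close (of_rat q) (sqrt (h x)) (sqrt (f x))"
          using close_ex[of "sqrt (h x)" "sqrt (f x)"] nn x by auto
        then have "x \<in> cell (q, False, i, j)" using x ij by (simp add: cell_def)
        then show ?thesis by blast
      qed
    qed (auto simp: cell_def close_def split: if_splits)
    finally show ?thesis .
  qed
  have fin: "emeasure L (D n) < \<infinity>" "emeasure X (D n) < \<infinity>"
    and bound: "(\<integral>\<^sup>+x\<in>D n. ennreal ((sqrt (f x) - sqrt (h x))\<^sup>2) \<partial>\<nu>)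
      \<le> ennreal (4 * (sqrt (measure L (D n)) - sqrt (measure X (D n)))\<^sup>2)" for n
  proof -
    obtain q s i j where z: "from_nat n = (q :: rat, s :: bool, i :: nat, j :: nat)"
      by (cases "from_nat n :: rat \<times> bool \<times> nat \<times> nat") auto
    have Dc: "D n \<subseteq> cell (q, s, i, j)" using DC[of n] by (simp add: C_def z)
    then have "D n \<subseteq> A i" "D n \<subseteq> B j" by (auto simp: cell_def)
    then have "emeasure L (D n) \<le> emeasure L (A i)" "emeasure X (D n) \<le> emeasure X (B j)"
      using AB sets by (auto intro!: emeasure_mono)
    then show fin: "emeasure L (D n) < \<infinity>" "emeasure X (D n) < \<infinity>"
      using A(3)[of i] B(3)[of j] by (auto simp: less_top top_unique)
    show "(\<integral>\<^sup>+x\<in>D n. ennreal ((sqrt (f x) - sqrt (h x))\<^sup>2) \<partial>\<nu>)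
      \<le> ennreal (4 * (sqrt (measure L (D n)) - sqrt (measure X (D n)))\<^sup>2)"
    proof (cases "D n = {}")
      case False
      then obtain x where x: "x \<in> D n" by blast
      \<comment> \<open>This needs a point of the cell: an empty cell may carry any rational
        \<open>q\<close>, even a negative one.\<close>
      have d: "0 < (of_rat q :: real) \<and> (of_rat q :: real) \<le> 2"
      proof -
        have *: "0 < d \<and> d \<le> 2" if "close d u v" "0 \<le> u" for d u v
        proof -
          have v: "v > 0" using that by (auto simp: close_def)
          have "0 < d * v" using that by (auto simp: close_def)
          then have "0 < d" using v by (simp add: zero_less_mult_iff)
          have "0 \<le> (1 - d / 2) * v" using that by (auto simp: close_def)
          then have "d \<le> 2" using v by (simp add: zero_le_mult_iff)
          then show ?thesis using \<open>0 < d\<close> by simp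
        qed
        have "x \<in> cell (q, s, i, j)" using x Dc by blast
        then show ?thesis
          using *[of "of_rat q"] nn by (cases s) (auto simp: cell_def)
      qed
      show ?thesis
      proof (cases s)
        case True
        then show ?thesis
          using Dc d fin by (intro hellinger_cell_bound[OF f h Dm, where d = "of_rat q"]) (auto simp: cell_def close_def)
      next
        case False
        have "(\<integral>\<^sup>+x\<in>D n. ennreal ((sqrt (h x) - sqrt (f x))\<^sup>2) \<partial>\<nu>)
            \<le> ennreal (4 * (sqrt (measure X (D n)) - sqrt (measure L (D n)))\<^sup>2)"
          using Dc d fin False
          by (intro hellinger_cell_bound[OF h f Dm, where d = "of_rat q"]) (auto simp: cell_def close_def)
        then show ?thesis by (simp add: power2_commute)
      qed
    qed simp
  qed
  let ?c = "\<lambda>n. (sqrt (measure L (D n)) - sqrt (measure X (D n)))\<^sup>2"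
  have "\<exists>N. K \<le> (\<Sum>i<N. ?c i)"
  proof (rule ccontr)
    assume "\<not> (\<exists>N. K \<le> (\<Sum>i<N. ?c i))"
    then have less: "(\<Sum>i<N. ?c i) \<le> K" for N by (meson linear)
    have "(\<integral>\<^sup>+x. ennreal ((sqrt (f x) - sqrt (h x))\<^sup>2) \<partial>\<nu>) = (\<integral>\<^sup>+x\<in>(\<Union>n. D n). ennreal ((sqrt (f x) - sqrt (h x))\<^sup>2) \<partial>\<nu>)"
      unfolding UD by (intro nn_integral_cong) (auto split: split_indicator)
    also have "\<dots> = (\<Sum>n. \<integral>\<^sup>+x\<in>D n. ennreal ((sqrt (f x) - sqrt (h x))\<^sup>2) \<partial>\<nu>)"
      by (rule nn_integral_disjoint_family) (use disj in auto)
    also have "\<dots> \<le> (\<Sum>n. ennreal (4 * ?c n))"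
      by (intro suminf_le bound) auto
    also have "\<dots> \<le> ennreal (4 * K)"
    proof (rule suminf_le_const)
      fix N
      have "(\<Sum>i<N. ennreal (4 * ?c i)) = ennreal (4 * (\<Sum>i<N. ?c i))"
        by (subst sum_ennreal) (auto simp: sum_distrib_left)
      also have "\<dots> \<le> ennreal (4 * K)" using less[of N] by (intro ennreal_leI) simp
      finally show "(\<Sum>i<N. ennreal (4 * ?c i)) \<le> ennreal (4 * K)" .
    qed simp
    finally show False using inf by (simp add: top_unique)
  qed
  then show ?thesis using disj Dm fin by blast
qed

text \<open>Otherwise there are tests whose two error probabilities are at most
  \<open>exp (- real n)\<close>. These are summable, so Borel-Cantelli applies under both laws and
  gives opposite eventual behaviour.\<close>

lemma finite_hellinger_of_absolutely_continuous:
  assumes PPL: "poisson_PP S L P" and PPX: "poisson_PP S X Q" and ac: "absolutely_continuous Q P"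
    and f: "is_density \<nu> L f" and h: "is_density \<nu> X h"
  shows "(\<integral>\<^sup>+x. ennreal ((sqrt (f x) - sqrt (h x))\<^sup>2) \<partial>\<nu>) < \<infinity>"
proof (rule ccontr)
  assume "\<not> ?thesis"
  then have inf: "(\<integral>\<^sup>+x. ennreal ((sqrt (f x) - sqrt (h x))\<^sup>2) \<partial>\<nu>) = \<infinity>" by (simp add: not_less top_unique)
  interpret P: prob_space P using PPL by (simp add: poisson_PP_def)
  interpret Q: prob_space Q using PPX by (simp add: poisson_PP_def)
  have sf: "sigma_finite_measure L" "sigma_finite_measure X" and sL: "sets L = sets S"
    and sPQ: "sets P = sets (point_pattern_space S)" "sets Q = sets (point_pattern_space S)"
    using PPL PPX by (auto simp: poisson_PP_def)
  have sp: "space P = space Q" using sPQ by (intro sets_eq_imp_space_eq) simp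
  have "\<exists>A\<in>sets (point_pattern_space S). Q.prob A \<le> exp (- real n) \<and> P.prob (space P - A) \<le> exp (- real n)" for n
  proof -
    \<comment> \<open>The target \<open>2 * real n\<close> compensates the factor one half in the
      exponent of the affinity.\<close>
    obtain N and D :: "nat \<Rightarrow> 'a set" where D: "disjoint_family D" "\<And>i. D i \<in> sets \<nu>"
      "\<And>i. emeasure L (D i) < \<infinity>" "\<And>i. emeasure X (D i) < \<infinity>"
      "2 * real n \<le> (\<Sum>i<N. (sqrt (measure L (D i)) - sqrt (measure X (D i)))\<^sup>2)"
      using finite_cells_of_infinite_hellinger[OF f h sf inf, of "2 * real n"] by blast
    have "D i \<in> sets S" for i using D(2) is_density_sets[OF f] sL by simp
    then interpret two_poisson_cells S L P X Q "{..<N}" D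
      using PPL PPX D by unfold_locales (auto simp: disjoint_family_on_def)
    have "exp (- (1 / 2) * (\<Sum>i<N. (sqrt (measure L (D i)) - sqrt (measure X (D i)))\<^sup>2)) \<le> exp (- real n)"
      using D(5) by simp
    then show ?thesis using separating_event by (meson order_trans)
  qed
  then obtain A where A: "\<And>n. A n \<in> sets (point_pattern_space S)" "\<And>n. Q.prob (A n) \<le> exp (- real n)"
    "\<And>n. P.prob (space P - A n) \<le> exp (- real n)" by metis
  have "summable (\<lambda>n. exp (- 1 :: real) ^ n)" by (rule summable_geometric) simp
  then have summ: "summable (\<lambda>n. exp (- real n))" by (simp flip: exp_of_nat_mult)
  have "AE x in Q. eventually (\<lambda>n. x \<in> space Q - A n) sequentially"
    using A sPQ by (intro borel_cantelli_AE1 summable_comparison_test'[OF summ])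
      (auto simp: P.emeasure_eq_measure Q.emeasure_eq_measure)
  \<comment> \<open>Absolute continuity moves the statement from \<open>Q\<close> to
    \<open>P\<close>, where it contradicts the Borel-Cantelli statement for the complements.\<close>
  then have "AE x in P. eventually (\<lambda>n. x \<in> space Q - A n) sequentially"
    using absolutely_continuous_AE[OF _ ac] sPQ by simp
  moreover have "AE x in P. eventually (\<lambda>n. x \<in> space P - (space P - A n)) sequentially"
    using A sPQ by (intro borel_cantelli_AE1 summable_comparison_test'[OF summ])
      (auto simp: P.emeasure_eq_measure Q.emeasure_eq_measure)
  ultimately have "AE x in P. False"
  proof eventually_elim
    case (elim x)
    then have "eventually (\<lambda>n. False) sequentially" by eventually_elim auto
    then show ?case by simp
  qed
  then show False by simp
qed

section \<open>From finite Hellinger distance to the chi-square bound\<close>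

text \<open>In essence the Cauchy-Schwarz inequality for the product of
  \<open>sqrt h - sqrt f\<close> and \<open>sqrt h + sqrt f\<close>, the latter being at most
  \<open>2 * sqrt h\<close>. It is carried out by a pointwise quadratic inequality with a parameter
  \<open>a\<close>, integrated and then evaluated at a suitable \<open>a\<close>.\<close>

lemma chi_square_cell_bound:
  assumes f: "is_density \<nu> L f" and h: "is_density \<nu> X h" and B: "B \<in> sets \<nu>" "emeasure X B < \<infinity>"
    and le: "\<And>x. x \<in> space \<nu> \<Longrightarrow> f x \<le> h x"
  shows "ennreal ((measure X B - measure L B)\<^sup>2 / measure X B) \<le> 4 * (\<integral>\<^sup>+x\<in>B. ennreal ((sqrt (f x) - sqrt (h x))\<^sup>2) \<partial>\<nu>)"
    (is "_ \<le> 4 * ?J")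
\<comment> \<open>For mass 0 the left side is 0 by the convention for division by zero; an infinite
  right side is trivial.\<close>
proof (cases "measure X B = 0 \<or> ?J = \<infinity>")
  case True
  then show ?thesis by (auto simp: ennreal_mult_top)
next
  case False
  have [measurable]: "f \<in> borel_measurable \<nu>" "h \<in> borel_measurable \<nu>" "B \<in> sets \<nu>"
    and nn: "\<And>x. x \<in> space \<nu> \<Longrightarrow> 0 \<le> f x" "\<And>x. x \<in> space \<nu> \<Longrightarrow> 0 \<le> h x"
    using f h B by (auto simp: is_density_def)
  have Bsp: "x \<in> space \<nu>" if "x \<in> B" for x using that B sets.sets_into_space by blast
  let ?l = "measure L B" and ?m = "measure X B"
  have "emeasure L B \<le> emeasure X B"
    unfolding is_density_emeasure[OF f B(1)] is_density_emeasure[OF h B(1)] using le Bsp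
    by (intro nn_integral_mono) (auto split: split_indicator intro: ennreal_leI)
  moreover from this have fL: "emeasure L B < \<infinity>" using B(2) by (rule le_less_trans)
  ultimately have lm: "?l \<le> ?m" using B(2) by (simp add: measure_def enn2real_mono)
  have L: "emeasure L B = ennreal ?l" and X: "emeasure X B = ennreal ?m"
    using fL B(2) by (simp_all add: emeasure_eq_ennreal_measure)
  \<comment> \<open>For this value \<open>a * ?m = ?m - ?l\<close>, so half of the left side
    \<open>2 * a * (?m - ?l)\<close> is absorbed by the term \<open>a\<^sup>2 * ?m\<close>.\<close>
  define a where "a = (?m - ?l) / ?m"
  have m: "?m > 0" using False measure_nonneg[of X B] by linarith
  have a: "a \<ge> 0" using lm m by (simp add: a_def)
  obtain J where J: "?J = ennreal J" "J \<ge> 0" using False by (cases ?J) auto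
  have "ennreal (2 * a) * emeasure X B = (\<integral>\<^sup>+x\<in>B. ennreal (2 * a) * ennreal (h x) \<partial>\<nu>)"
    unfolding is_density_emeasure[OF h B(1)] by (subst nn_integral_cmult[symmetric]) (auto simp: mult.assoc)
  \<comment> \<open>The term with \<open>f\<close> is kept on the right in order to avoid
    subtraction in \<open>ennreal\<close>.\<close>
  also have "\<dots> \<le> (\<integral>\<^sup>+x. 4 * (ennreal ((sqrt (f x) - sqrt (h x))\<^sup>2) * indicator B x) +
      (ennreal (a\<^sup>2) * (ennreal (h x) * indicator B x) + ennreal (2 * a) * (ennreal (f x) * indicator B x)) \<partial>\<nu>)"
  proof (rule nn_integral_mono)
    fix x
    show "ennreal (2 * a) * ennreal (h x) * indicator B x \<le> 4 * (ennreal ((sqrt (f x) - sqrt (h x))\<^sup>2) * indicator B x) +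
      (ennreal (a\<^sup>2) * (ennreal (h x) * indicator B x) + ennreal (2 * a) * (ennreal (f x) * indicator B x))"
    proof (cases "x \<in> B")
      case True
      define u v where "u = sqrt (f x)" and "v = sqrt (h x)"
      have uv: "0 \<le> u" "u \<le> v" "u\<^sup>2 = f x" "v\<^sup>2 = h x"
        using nn le Bsp[OF True] by (auto simp: u_def v_def)
      have "2 * a * (v\<^sup>2 - u\<^sup>2) = 2 * a * ((v - u) * (v + u))" by (simp add: power2_eq_square algebra_simps)
      also have "\<dots> \<le> 2 * a * ((v - u) * (2 * v))" using a uv by (intro mult_left_mono) auto
      also have "\<dots> \<le> 4 * (u - v)\<^sup>2 + a\<^sup>2 * v\<^sup>2"
        using zero_le_power2[of "2 * (v - u) - a * v"] by (simp add: power2_eq_square algebra_simps)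
      finally have "2 * a * h x \<le> 4 * (sqrt (f x) - sqrt (h x))\<^sup>2 + (a\<^sup>2 * h x + 2 * a * f x)"
        using uv by (simp add: u_def v_def algebra_simps)
      then have "ennreal (2 * a * h x) \<le> ennreal (4 * (sqrt (f x) - sqrt (h x))\<^sup>2 + (a\<^sup>2 * h x + 2 * a * f x))"
        by (rule ennreal_leI)
      also have "\<dots> = 4 * ennreal ((sqrt (f x) - sqrt (h x))\<^sup>2) + (ennreal (a\<^sup>2) * ennreal (h x) + ennreal (2 * a) * ennreal (f x))"
        using a nn Bsp[OF True] by (simp add: ennreal_plus ennreal_mult flip: ennreal_numeral)
      finally show ?thesis using True a nn Bsp[OF True] by (simp add: ennreal_mult)
    qed simp
  qed
  also have "\<dots> = 4 * ?J + (ennreal (a\<^sup>2) * emeasure X B + ennreal (2 * a) * emeasure L B)"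
    unfolding is_density_emeasure[OF h B(1)] is_density_emeasure[OF f B(1)]
    by (simp add: nn_integral_add nn_integral_cmult)
  also have "\<dots> = ennreal (4 * J + (a\<^sup>2 * ?m + 2 * a * ?l))"
    unfolding J L X using a J(2) by (simp add: ennreal_plus ennreal_mult flip: ennreal_numeral)
  finally have "ennreal (2 * a * ?m) \<le> ennreal (4 * J + (a\<^sup>2 * ?m + 2 * a * ?l))"
    using a by (simp add: X ennreal_mult)
  then have "2 * a * ?m \<le> 4 * J + (a\<^sup>2 * ?m + 2 * a * ?l)"
    using a J(2) by (subst (asm) ennreal_le_iff) auto
  then have "2 * a * (?m - ?l) - a * (a * ?m) \<le> 4 * J" by (simp add: power2_eq_square algebra_simps)
  moreover have am: "a * ?m = ?m - ?l" using m by (simp add: a_def)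
  ultimately have "a * (?m - ?l) \<le> 4 * J" by simp
  then have "(?m - ?l)\<^sup>2 / ?m \<le> 4 * J" by (simp add: a_def power2_eq_square)
  then have "ennreal ((?m - ?l)\<^sup>2 / ?m) \<le> ennreal (4 * J)" by (rule ennreal_leI)
  then show ?thesis using J by (simp add: ennreal_mult)
qed

text \<open>The chi-square terms of disjoint cells are bounded by four times the integrals over
  these cells, which add up to at most the total integral; this supplies a \<kappa> that does not
  depend on the cells.\<close>

lemma absolutely_continuous_of_finite_hellinger:
  assumes PPL: "poisson_PP S L P" and PPX: "poisson_PP S X Q"
    and f: "is_density \<nu> L f" and h: "is_density \<nu> X h"
    and le: "\<And>x. x \<in> space \<nu> \<Longrightarrow> f x \<le> h x"
    and fin: "(\<integral>\<^sup>+x. ennreal ((sqrt (f x) - sqrt (h x))\<^sup>2) \<partial>\<nu>) < \<infinity>" (is "?J < _")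
  shows "absolutely_continuous Q P"
proof -
  have [measurable]: "f \<in> borel_measurable \<nu>" "h \<in> borel_measurable \<nu>"
    using f h by (auto simp: is_density_def)
  have S: "sets \<nu> = sets S" using PPL is_density_sets[OF f] by (simp add: poisson_PP_def)
  have LX: "emeasure L B \<le> emeasure X B" if "B \<in> sets S" for B
  proof -
    have B: "B \<in> sets \<nu>" using that S by simp
    then have "x \<in> space \<nu>" if "x \<in> B" for x using that sets.sets_into_space by blast
    then show ?thesis
      unfolding is_density_emeasure[OF f B] is_density_emeasure[OF h B] using le
      by (intro nn_integral_mono) (auto split: split_indicator intro: ennreal_leI)
  qed
  obtain J where J: "?J = ennreal J" "J \<ge> 0" using fin by (cases ?J) auto
  have "(\<Sum>B\<in>C. (measure X B - measure L B)\<^sup>2 / measure X B) \<le> 4 * J"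
    if C: "finite C" "C \<subseteq> {B \<in> sets S. emeasure X B < \<infinity>}" "disjoint C" for C
  proof -
    have C\<nu>: "C \<subseteq> sets \<nu>" using C S by auto
    have "ennreal (\<Sum>B\<in>C. (measure X B - measure L B)\<^sup>2 / measure X B)
      = (\<Sum>B\<in>C. ennreal ((measure X B - measure L B)\<^sup>2 / measure X B))"
      by (subst sum_ennreal) auto
    also have "\<dots> \<le> (\<Sum>B\<in>C. 4 * (\<integral>\<^sup>+x\<in>B. ennreal ((sqrt (f x) - sqrt (h x))\<^sup>2) \<partial>\<nu>))"
      using C C\<nu> by (intro sum_mono chi_square_cell_bound[OF f h _ _ le]) auto
    \<comment> \<open>The integrals over cells are read as values of one measure, so that additivity
      and monotonicity apply.\<close>
    also have "\<dots> = 4 * (\<Sum>B\<in>C. emeasure (density \<nu> (\<lambda>x. ennreal ((sqrt (f x) - sqrt (h x))\<^sup>2))) B)"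
      using C\<nu> by (auto simp: sum_distrib_left emeasure_density intro!: sum.cong)
    also have "(\<Sum>B\<in>C. emeasure (density \<nu> (\<lambda>x. ennreal ((sqrt (f x) - sqrt (h x))\<^sup>2))) B)
      = emeasure (density \<nu> (\<lambda>x. ennreal ((sqrt (f x) - sqrt (h x))\<^sup>2))) (\<Union>B\<in>C. B)"
      using C C\<nu> by (intro sum_emeasure) (auto simp: disjoint_def disjoint_family_on_def)
    also have "\<dots> \<le> emeasure (density \<nu> (\<lambda>x. ennreal ((sqrt (f x) - sqrt (h x))\<^sup>2))) (space \<nu>)"
      using emeasure_space[of "density \<nu> (\<lambda>x. ennreal ((sqrt (f x) - sqrt (h x))\<^sup>2))"] by simp
    also have "\<dots> = ?J" by (simp add: emeasure_density cong: nn_integral_cong)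
    finally have "ennreal (\<Sum>B\<in>C. (measure X B - measure L B)\<^sup>2 / measure X B) \<le> ennreal (4 * J)"
      using J by (simp add: ennreal_mult mult_left_mono)
    then show ?thesis
      using J by (subst (asm) ennreal_le_iff) auto
  qed
  with LX show ?thesis by (rule absolutely_continuous_poisson_PP[OF PPL PPX])
qed

section \<open>Finiteness of the Hellinger distance and common dominating processes\<close>

text \<open>Removes the factor one half and the root, neither of which affects finiteness, and
  allows any convenient dominating measure.\<close>

lemma hellinger_finite_iff:
  assumes "sigma_finite_measure \<nu>" "is_density \<nu> L f" "is_density \<nu> M g"
  shows "hellinger L M < \<infinity> \<longleftrightarrow> (\<integral>\<^sup>+x. ennreal ((sqrt (f x) - sqrt (g x))\<^sup>2) \<partial>\<nu>) < \<infinity>"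
proof -
  have half: "(1 / 2 :: ennreal) = ennreal (1 / 2)"
    by (simp add: divide_ennreal_def flip: ennreal_numeral)
  show ?thesis
    unfolding hellinger_eq[OF assms] hellinger_integral_def sqrt_ennreal_def half
    by (auto simp: less_top ennreal_mult_eq_top_iff)
qed

theorem theorem5p7:
  fixes S \<Lambda> M :: "'a measure" and P\<^sub>\<Lambda> P\<^sub>M :: "'a measure measure"
  assumes "poisson_PP S \<Lambda> P\<^sub>\<Lambda>"
    and "poisson_PP S M P\<^sub>M"
  shows "(\<exists>\<Xi> P\<^sub>\<Xi>. poisson_PP S \<Xi> P\<^sub>\<Xi> \<and>
            absolutely_continuous P\<^sub>\<Xi> P\<^sub>\<Lambda> \<and> absolutely_continuous P\<^sub>\<Xi> P\<^sub>M)
         \<longleftrightarrow> hellinger \<Lambda> M < \<infinity>"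
proof
  have sf: "sigma_finite_measure \<Lambda>" "sigma_finite_measure M" and sets: "sets \<Lambda> = sets S" "sets M = sets S"
    using assms by (auto simp: poisson_PP_def)
  {
    assume "\<exists>\<Xi> P\<^sub>\<Xi>. poisson_PP S \<Xi> P\<^sub>\<Xi> \<and>
      absolutely_continuous P\<^sub>\<Xi> P\<^sub>\<Lambda> \<and> absolutely_continuous P\<^sub>\<Xi> P\<^sub>M"
    then obtain \<Xi> Q where Q: "poisson_PP S \<Xi> Q" "absolutely_continuous Q P\<^sub>\<Lambda>" "absolutely_continuous Q P\<^sub>M"
      by blast
    have \<Xi>: "sigma_finite_measure \<Xi>" "sets \<Xi> = sets S" using Q(1) by (auto simp: poisson_PP_def)
    \<comment> \<open>All three intensities need densities with respect to one measure, and their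
      sum dominates each.\<close>
    define \<nu> where "\<nu> = measure_add (measure_add \<Lambda> M) \<Xi>"
    have \<nu>: "sigma_finite_measure \<nu>" "sets \<nu> = sets S"
      unfolding \<nu>_def using sf sets \<Xi> by (auto intro!: sigma_finite_measure_add)
    have em: "emeasure \<nu> B = emeasure \<Lambda> B + emeasure M B + emeasure \<Xi> B" if "B \<in> sets \<nu>" for B
      using that sets \<Xi> \<nu>(2) by (simp add: \<nu>_def emeasure_measure_add)
    have "\<exists>f. is_density \<nu> \<Lambda> f"
      using sets \<nu> sf by (intro is_density_exists) (auto simp: em add.assoc)
    moreover have "\<exists>g. is_density \<nu> M g"
      using sets \<nu> sf by (intro is_density_exists) (auto simp: em add.assoc add.left_commute)
    moreover have "\<exists>h. is_density \<nu> \<Xi> h"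
      using \<Xi> \<nu> by (intro is_density_exists) (auto simp: em)
    ultimately obtain f g h where d: "is_density \<nu> \<Lambda> f" "is_density \<nu> M g" "is_density \<nu> \<Xi> h"
      by blast
    then have [measurable]: "f \<in> borel_measurable \<nu>" "g \<in> borel_measurable \<nu>" "h \<in> borel_measurable \<nu>"
      by (auto simp: is_density_def)
    have "(\<integral>\<^sup>+x. ennreal ((sqrt (f x) - sqrt (g x))\<^sup>2) \<partial>\<nu>)
      \<le> (\<integral>\<^sup>+x. 2 * ennreal ((sqrt (f x) - sqrt (h x))\<^sup>2) + 2 * ennreal ((sqrt (g x) - sqrt (h x))\<^sup>2) \<partial>\<nu>)"
    proof (rule nn_integral_mono)
      fix x
      \<comment> \<open>The triangle inequality in squared form, which is enough for finiteness and
        needs no root of an integral.\<close>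
      have "(u - v)\<^sup>2 \<le> 2 * (u - w)\<^sup>2 + 2 * (v - w)\<^sup>2" for u v w :: real
        using zero_le_power2[of "u + v - 2 * w"] by (simp add: power2_eq_square algebra_simps)
      then have "ennreal ((sqrt (f x) - sqrt (g x))\<^sup>2)
          \<le> ennreal (2 * (sqrt (f x) - sqrt (h x))\<^sup>2 + 2 * (sqrt (g x) - sqrt (h x))\<^sup>2)"
        by (intro ennreal_leI)
      then show "ennreal ((sqrt (f x) - sqrt (g x))\<^sup>2)
          \<le> 2 * ennreal ((sqrt (f x) - sqrt (h x))\<^sup>2) + 2 * ennreal ((sqrt (g x) - sqrt (h x))\<^sup>2)"
        by (simp add: ennreal_mult ennreal_plus)
    qed
    also have "\<dots> = 2 * (\<integral>\<^sup>+x. ennreal ((sqrt (f x) - sqrt (h x))\<^sup>2) \<partial>\<nu>) +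
        2 * (\<integral>\<^sup>+x. ennreal ((sqrt (g x) - sqrt (h x))\<^sup>2) \<partial>\<nu>)"
      by (simp add: nn_integral_add nn_integral_cmult)
    also have "\<dots> < \<infinity>"
      using finite_hellinger_of_absolutely_continuous[OF assms(1) Q(1,2) d(1,3)]
        finite_hellinger_of_absolutely_continuous[OF assms(2) Q(1,3) d(2,3)]
      by (auto simp: ennreal_mult_less_top)
    finally show "hellinger \<Lambda> M < \<infinity>"
      using hellinger_finite_iff[OF \<nu>(1) d(1,2)] by simp
  next
    assume H: "hellinger \<Lambda> M < \<infinity>"
    define \<nu> where "\<nu> = measure_add \<Lambda> M"
    have \<nu>: "sigma_finite_measure \<nu>" "sets \<nu> = sets S"
      unfolding \<nu>_def using sf sets by (auto intro!: sigma_finite_measure_add)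
    have em: "emeasure \<nu> B = emeasure \<Lambda> B + emeasure M B" if "B \<in> sets \<nu>" for B
      using that sets \<nu>(2) by (simp add: \<nu>_def emeasure_measure_add)
    have "\<exists>f. is_density \<nu> \<Lambda> f" "\<exists>g. is_density \<nu> M g"
      using sets \<nu> sf by (auto intro!: is_density_exists simp: em)
    then obtain f g where d: "is_density \<nu> \<Lambda> f" "is_density \<nu> M g"
      by blast
    then have [measurable]: "f \<in> borel_measurable \<nu>" "g \<in> borel_measurable \<nu>"
      and nn: "\<And>x. x \<in> space \<nu> \<Longrightarrow> 0 \<le> f x" "\<And>x. x \<in> space \<nu> \<Longrightarrow> 0 \<le> g x"
      by (auto simp: is_density_def)
    have fin: "(\<integral>\<^sup>+x. ennreal ((sqrt (f x) - sqrt (g x))\<^sup>2) \<partial>\<nu>) < \<infinity>"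
      using H hellinger_finite_iff[OF \<nu>(1) d] by simp
    \<comment> \<open>The larger density is \<open>f\<close> on \<open>A\<close> and
      \<open>g\<close> off \<open>A\<close>, so the measure with density
      \<open>max (f x) (g x)\<close> is a splice and a Poisson process with it as intensity is at
      hand.\<close>
    define A where "A = {x \<in> space \<nu>. g x \<le> f x}"
    have A\<nu>[measurable]: "A \<in> sets \<nu>" unfolding A_def by measurable
    then have A: "A \<in> sets S" using \<nu> by simp
    define h where "h x = max (f x) (g x)" for x
    have h[measurable]: "h \<in> borel_measurable \<nu>" unfolding h_def by measurable
    let ?\<Xi> = "splice_measure A \<Lambda> M"
    obtain Q where Q: "poisson_PP S ?\<Xi> Q" using poisson_PP_splice_measure[OF assms A] by blast
    have dh: "is_density \<nu> ?\<Xi> h"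
      unfolding is_density_def
    proof (intro conjI ballI)
      show "density \<nu> (\<lambda>x. ennreal (h x)) = ?\<Xi>"
      proof (rule measure_eqI)
        fix B assume "B \<in> sets (density \<nu> (\<lambda>x. ennreal (h x)))"
        then have B[measurable]: "B \<in> sets \<nu>" by simp
        have BA: "B \<inter> A \<in> sets \<nu>" "B - A \<in> sets \<nu>" using B A\<nu> by auto
        have "emeasure (density \<nu> (\<lambda>x. ennreal (h x))) B = (\<integral>\<^sup>+x\<in>B. ennreal (h x) \<partial>\<nu>)"
          by (simp add: emeasure_density)
        also have "\<dots> = (\<integral>\<^sup>+x. ennreal (f x) * indicator (B \<inter> A) x + ennreal (g x) * indicator (B - A) x \<partial>\<nu>)"
          by (intro nn_integral_cong) (auto simp: h_def A_def max_def split: split_indicator)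
        also have "\<dots> = emeasure \<Lambda> (B \<inter> A) + emeasure M (B - A)"
          unfolding is_density_emeasure[OF d(1) BA(1)] is_density_emeasure[OF d(2) BA(2)]
          using BA by (intro nn_integral_add) auto
        also have "\<dots> = emeasure ?\<Xi> B"
          using sets \<nu> A B by (subst emeasure_splice_measure) auto
        finally show "emeasure (density \<nu> (\<lambda>x. ennreal (h x))) B = emeasure ?\<Xi> B" .
      qed (simp add: sets \<nu>)
    qed (auto simp: h_def nn le_max_iff_disj)
    \<comment> \<open>At each point \<open>h\<close> equals \<open>f\<close> or \<open>g\<close>, so
      each integrand on the left is either 0 or the one on the right.\<close>
    have "(\<integral>\<^sup>+x. ennreal ((sqrt (f x) - sqrt (h x))\<^sup>2) \<partial>\<nu>) \<le> (\<integral>\<^sup>+x. ennreal ((sqrt (f x) - sqrt (g x))\<^sup>2) \<partial>\<nu>)"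
      "(\<integral>\<^sup>+x. ennreal ((sqrt (g x) - sqrt (h x))\<^sup>2) \<partial>\<nu>) \<le> (\<integral>\<^sup>+x. ennreal ((sqrt (f x) - sqrt (g x))\<^sup>2) \<partial>\<nu>)"
      by (auto intro!: nn_integral_mono simp: h_def max_def power2_commute)
    then have "(\<integral>\<^sup>+x. ennreal ((sqrt (f x) - sqrt (h x))\<^sup>2) \<partial>\<nu>) < \<infinity>"
      "(\<integral>\<^sup>+x. ennreal ((sqrt (g x) - sqrt (h x))\<^sup>2) \<partial>\<nu>) < \<infinity>"
      using fin by (auto intro: le_less_trans)
    then have "absolutely_continuous Q P\<^sub>\<Lambda>" "absolutely_continuous Q P\<^sub>M"
      using absolutely_continuous_of_finite_hellinger[OF assms(1) Q d(1) dh]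
        absolutely_continuous_of_finite_hellinger[OF assms(2) Q d(2) dh]
      by (simp_all add: h_def)
    then show "\<exists>\<Xi> P\<^sub>\<Xi>. poisson_PP S \<Xi> P\<^sub>\<Xi> \<and>
      absolutely_continuous P\<^sub>\<Xi> P\<^sub>\<Lambda> \<and> absolutely_continuous P\<^sub>\<Xi> P\<^sub>M"
      using Q by blast
  }
qed

end
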